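(* Let $\mathcal{A}$ be an abelian category with a generator, small direct sums and exact small products. For an inverse sequence $S$ in $\mathcal{A}$ there exists a unique (up to isomorphism) short exact sequence of inverse sequences $$E \rightarrowtail S \twoheadrightarrow S'$$ such that $E$ is epimorphic and $\lim S'=0$. Moreover, for such an exact sequence we have $\lim^1 S \cong \lim^1 S'$.
   Context: A generator of $\mathcal{A}$ is an object $G$ such that the functor $\mathcal{A}(G,-)$ is faithful. An inverse sequence $S$ in $\mathcal{A}$ consists of objects $S_i$ and morphisms $f_i:S_{i+1}\to S_i$, $i\in\omega=\{0,1,2,\dots\}$, i.e. it is a functor $\omega^{\mathrm{op}}\to\mathcal{A}$; inverse sequences form an abelian category, with kernels and cokernels computed componentwise. The objects $\lim S$ and $\lim^1 S$ (the limit and its first right derived functor) are the kernel and the cokernel of $1-F:\prod_i S_i\to\prod_i S_i$, where $\mathrm{pr}_jF=f_j\,\mathrm{pr}_{j+1}$. An inverse sequence is called epimorphic if all the maps $f_i$ are epimorphisms. *)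

theory Defs
  imports "HOL-Algebra.Group"
begin

section \<open>Categories and preadditive categories\<close>

record ('o, 'm) precat =
  Obj :: "'o set"
  Arr :: "'m set"
  Dom :: "'m \<Rightarrow> 'o"
  Cod :: "'m \<Rightarrow> 'o"
  Ident :: "'o \<Rightarrow> 'm"
  Comp :: "'m \<Rightarrow> 'm \<Rightarrow> 'm"  (infixl "\<cdot>\<index>" 70)  \<comment> \<open>\<open>g \<cdot> f\<close> is \<open>g\<close> after \<open>f\<close>\<close>
  Add :: "'m \<Rightarrow> 'm \<Rightarrow> 'm"
  Zero :: "'o \<Rightarrow> 'o \<Rightarrow> 'm"

definition Hom :: "('o, 'm) precat \<Rightarrow> 'o \<Rightarrow> 'o \<Rightarrow> 'm set" where
  "Hom C a b = {f \<in> Arr C. Dom C f = a \<and> Cod C f = b}"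

definition hom_group :: "('o, 'm) precat \<Rightarrow> 'o \<Rightarrow> 'o \<Rightarrow> 'm monoid" where
  "hom_group C a b = \<lparr>carrier = Hom C a b, mult = Add C, one = Zero C a b\<rparr>"

definition Diff :: "('o, 'm) precat \<Rightarrow> 'm \<Rightarrow> 'm \<Rightarrow> 'm" where
  "Diff C f g = Add C f (inv\<^bsub>hom_group C (Dom C g) (Cod C g)\<^esub> g)"

locale category =
  fixes C :: "('o, 'm) precat" (structure)
  assumes Dom_Obj: "f \<in> Arr C \<Longrightarrow> Dom C f \<in> Obj C"
    and Cod_Obj: "f \<in> Arr C \<Longrightarrow> Cod C f \<in> Obj C"
    and Ident_Hom: "a \<in> Obj C \<Longrightarrow> Ident C a \<in> Hom C a a"
    and Comp_Hom: "\<lbrakk>f \<in> Hom C a b; g \<in> Hom C b c\<rbrakk> \<Longrightarrow> g \<cdot> f \<in> Hom C a c"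
    and Comp_Ident: "f \<in> Hom C a b \<Longrightarrow> f \<cdot> Ident C a = f"
    and Ident_Comp: "f \<in> Hom C a b \<Longrightarrow> Ident C b \<cdot> f = f"
    and Comp_assoc: "\<lbrakk>f \<in> Hom C a b; g \<in> Hom C b c; h \<in> Hom C c d\<rbrakk>
      \<Longrightarrow> (h \<cdot> g) \<cdot> f = h \<cdot> (g \<cdot> f)"

locale preadditive_category = category +
  assumes hom_comm_group: "\<lbrakk>a \<in> Obj C; b \<in> Obj C\<rbrakk> \<Longrightarrow> comm_group (hom_group C a b)"
    and Comp_Add_right: "\<lbrakk>f \<in> Hom C a b; g \<in> Hom C a b; h \<in> Hom C b c\<rbrakk>
      \<Longrightarrow> h \<cdot> Add C f g = Add C (h \<cdot> f) (h \<cdot> g)"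
    and Comp_Add_left: "\<lbrakk>f \<in> Hom C a b; h \<in> Hom C b c; k \<in> Hom C b c\<rbrakk>
      \<Longrightarrow> Add C h k \<cdot> f = Add C (h \<cdot> f) (k \<cdot> f)"

section \<open>Notions in a category\<close>

definition monic :: "('o, 'm) precat \<Rightarrow> 'm \<Rightarrow> bool" where
  "monic C f \<longleftrightarrow> f \<in> Arr C \<and>
    (\<forall>a \<in> Obj C. \<forall>g \<in> Hom C a (Dom C f). \<forall>h \<in> Hom C a (Dom C f).
      f \<cdot>\<^bsub>C\<^esub> g = f \<cdot>\<^bsub>C\<^esub> h \<longrightarrow> g = h)"

definition epic :: "('o, 'm) precat \<Rightarrow> 'm \<Rightarrow> bool" where
  "epic C f \<longleftrightarrow> f \<in> Arr C \<and>
    (\<forall>b \<in> Obj C. \<forall>g \<in> Hom C (Cod C f) b. \<forall>h \<in> Hom C (Cod C f) b.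
      g \<cdot>\<^bsub>C\<^esub> f = h \<cdot>\<^bsub>C\<^esub> f \<longrightarrow> g = h)"

definition isomorphism :: "('o, 'm) precat \<Rightarrow> 'm \<Rightarrow> bool" where
  "isomorphism C f \<longleftrightarrow> f \<in> Arr C \<and>
    (\<exists>g \<in> Hom C (Cod C f) (Dom C f).
      g \<cdot>\<^bsub>C\<^esub> f = Ident C (Dom C f) \<and> f \<cdot>\<^bsub>C\<^esub> g = Ident C (Cod C f))"

definition isomorphic :: "('o, 'm) precat \<Rightarrow> 'o \<Rightarrow> 'o \<Rightarrow> bool" where
  "isomorphic C a b \<longleftrightarrow> (\<exists>f \<in> Hom C a b. isomorphism C f)"

definition zero_object :: "('o, 'm) precat \<Rightarrow> 'o \<Rightarrow> bool" where
  "zero_object C z \<longleftrightarrow> z \<in> Obj C \<and>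
    (\<forall>a \<in> Obj C. (\<exists>!f. f \<in> Hom C a z) \<and> (\<exists>!f. f \<in> Hom C z a))"

definition is_kernel :: "('o, 'm) precat \<Rightarrow> 'm \<Rightarrow> 'm \<Rightarrow> bool" where
  "is_kernel C k f \<longleftrightarrow> k \<in> Arr C \<and> f \<in> Arr C \<and> Cod C k = Dom C f \<and>
    f \<cdot>\<^bsub>C\<^esub> k = Zero C (Dom C k) (Cod C f) \<and>
    (\<forall>a \<in> Obj C. \<forall>g \<in> Hom C a (Dom C f). f \<cdot>\<^bsub>C\<^esub> g = Zero C a (Cod C f) \<longrightarrow>
      (\<exists>!u. u \<in> Hom C a (Dom C k) \<and> k \<cdot>\<^bsub>C\<^esub> u = g))"

definition is_cokernel :: "('o, 'm) precat \<Rightarrow> 'm \<Rightarrow> 'm \<Rightarrow> bool" where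
  "is_cokernel C c f \<longleftrightarrow> c \<in> Arr C \<and> f \<in> Arr C \<and> Dom C c = Cod C f \<and>
    c \<cdot>\<^bsub>C\<^esub> f = Zero C (Dom C f) (Cod C c) \<and>
    (\<forall>b \<in> Obj C. \<forall>g \<in> Hom C (Cod C f) b. g \<cdot>\<^bsub>C\<^esub> f = Zero C (Dom C f) b \<longrightarrow>
      (\<exists>!u. u \<in> Hom C (Cod C c) b \<and> u \<cdot>\<^bsub>C\<^esub> c = g))"

definition short_exact :: "('o, 'm) precat \<Rightarrow> 'm \<Rightarrow> 'm \<Rightarrow> bool" where
  "short_exact C i p \<longleftrightarrow> is_kernel C i p \<and> is_cokernel C p i"

definition is_product ::
  "('o, 'm) precat \<Rightarrow> 'i set \<Rightarrow> ('i \<Rightarrow> 'o) \<Rightarrow> 'o \<Rightarrow> ('i \<Rightarrow> 'm) \<Rightarrow> bool" where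
  "is_product C I X P pr \<longleftrightarrow> P \<in> Obj C \<and> (\<forall>i \<in> I. pr i \<in> Hom C P (X i)) \<and>
    (\<forall>Q \<in> Obj C. \<forall>q. (\<forall>i \<in> I. q i \<in> Hom C Q (X i)) \<longrightarrow>
      (\<exists>!u. u \<in> Hom C Q P \<and> (\<forall>i \<in> I. pr i \<cdot>\<^bsub>C\<^esub> u = q i)))"

definition is_coproduct ::
  "('o, 'm) precat \<Rightarrow> 'i set \<Rightarrow> ('i \<Rightarrow> 'o) \<Rightarrow> 'o \<Rightarrow> ('i \<Rightarrow> 'm) \<Rightarrow> bool" where
  "is_coproduct C I X P \<iota> \<longleftrightarrow> P \<in> Obj C \<and> (\<forall>i \<in> I. \<iota> i \<in> Hom C (X i) P) \<and>
    (\<forall>Q \<in> Obj C. \<forall>q. (\<forall>i \<in> I. q i \<in> Hom C (X i) Q) \<longrightarrow>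
      (\<exists>!u. u \<in> Hom C P Q \<and> (\<forall>i \<in> I. u \<cdot>\<^bsub>C\<^esub> \<iota> i = q i)))"

definition generator :: "('o, 'm) precat \<Rightarrow> 'o \<Rightarrow> bool" where
  "generator C G \<longleftrightarrow> G \<in> Obj C \<and>
    (\<forall>a \<in> Obj C. \<forall>b \<in> Obj C. \<forall>f \<in> Hom C a b. \<forall>g \<in> Hom C a b.
      (\<forall>x \<in> Hom C G a. f \<cdot>\<^bsub>C\<^esub> x = g \<cdot>\<^bsub>C\<^esub> x) \<longrightarrow> f = g)"

section \<open>Abelian categories\<close>

text \<open>In a preadditive category finite products are biproducts, so requiring binary products
  suffices for additivity.\<close>

locale abelian_category = preadditive_category +
  assumes zero_object_ex: "\<exists>z. zero_object C z"
    and binary_product_ex: "\<lbrakk>a \<in> Obj C; b \<in> Obj C\<rbrakk>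
      \<Longrightarrow> \<exists>P pr. is_product C (UNIV :: bool set) (\<lambda>t. if t then a else b) P pr"
    and kernel_ex: "f \<in> Arr C \<Longrightarrow> \<exists>k. is_kernel C k f"
    and cokernel_ex: "f \<in> Arr C \<Longrightarrow> \<exists>c. is_cokernel C c f"
    and monic_is_kernel: "monic C f \<Longrightarrow> \<exists>g. is_kernel C f g"
    and epic_is_cokernel: "epic C f \<Longrightarrow> \<exists>g. is_cokernel C f g"

section \<open>Smallness\<close>

text \<open>Smallness is relative to a universe, given by an uncountable strongly inaccessible
  cardinal \<open>\<kappa>\<close>: the small sets are those of cardinality less than \<open>\<kappa>\<close>. As usual, a category is
  understood to have small hom-sets, while its objects may form a set of any cardinality. Every
  small set is equipotent to a set of elements of the type \<open>'k\<close> underlying \<open>\<kappa>\<close>, so families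
  indexed by small sets of type \<open>'k set\<close> represent all small families.\<close>

unbundle cardinal_syntax

definition inaccessible :: "'k rel \<Rightarrow> bool" where
  "inaccessible \<kappa> \<longleftrightarrow> Card_order \<kappa> \<and> natLeq <o \<kappa> \<and> regularCard \<kappa> \<and>
    (\<forall>A :: 'k set. |A| <o \<kappa> \<longrightarrow> |Pow A| <o \<kappa>)"

definition small :: "'k rel \<Rightarrow> 'a set \<Rightarrow> bool" where
  "small \<kappa> A \<longleftrightarrow> |A| <o \<kappa>"

unbundle no cardinal_syntax

definition locally_small :: "'k rel \<Rightarrow> ('o, 'm) precat \<Rightarrow> bool" where
  "locally_small \<kappa> C \<longleftrightarrow> (\<forall>a \<in> Obj C. \<forall>b \<in> Obj C. small \<kappa> (Hom C a b))"

definition has_small_coproducts :: "'k rel \<Rightarrow> ('o, 'm) precat \<Rightarrow> bool" where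
  "has_small_coproducts \<kappa> C \<longleftrightarrow>
    (\<forall>(I :: 'k set) X. small \<kappa> I \<and> (\<forall>i \<in> I. X i \<in> Obj C) \<longrightarrow> (\<exists>P \<iota>. is_coproduct C I X P \<iota>))"

definition has_small_products :: "'k rel \<Rightarrow> ('o, 'm) precat \<Rightarrow> bool" where
  "has_small_products \<kappa> C \<longleftrightarrow>
    (\<forall>(I :: 'k set) X. small \<kappa> I \<and> (\<forall>i \<in> I. X i \<in> Obj C) \<longrightarrow> (\<exists>P pr. is_product C I X P pr))"

text \<open>Products are exact: the morphisms \<open>u\<close>, \<open>v\<close> induced on the products by a small family of
  short exact sequences again form a short exact sequence.\<close>

definition small_products_exact :: "'k rel \<Rightarrow> ('o, 'm) precat \<Rightarrow> bool" where
  "small_products_exact \<kappa> C \<longleftrightarrow>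
    (\<forall>(I :: 'k set) X Y Z i p PX prX PY prY PZ prZ u v.
      small \<kappa> I \<and>
      (\<forall>j \<in> I. i j \<in> Hom C (X j) (Y j) \<and> p j \<in> Hom C (Y j) (Z j) \<and> short_exact C (i j) (p j)) \<and>
      is_product C I X PX prX \<and> is_product C I Y PY prY \<and> is_product C I Z PZ prZ \<and>
      u \<in> Hom C PX PY \<and> (\<forall>j \<in> I. prY j \<cdot>\<^bsub>C\<^esub> u = i j \<cdot>\<^bsub>C\<^esub> prX j) \<and>
      v \<in> Hom C PY PZ \<and> (\<forall>j \<in> I. prZ j \<cdot>\<^bsub>C\<^esub> v = p j \<cdot>\<^bsub>C\<^esub> prY j)
      \<longrightarrow> short_exact C u v)"

section \<open>Inverse sequences\<close>

record ('o, 'm) invseq =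
  ob :: "nat \<Rightarrow> 'o"
  bond :: "nat \<Rightarrow> 'm"

definition inverse_sequence :: "('o, 'm) precat \<Rightarrow> ('o, 'm) invseq \<Rightarrow> bool" where
  "inverse_sequence C S \<longleftrightarrow>
    (\<forall>i. ob S i \<in> Obj C \<and> bond S i \<in> Hom C (ob S (Suc i)) (ob S i))"

text \<open>A morphism of inverse sequences is a triple of its source, its components and its target.\<close>

definition invseq_cat ::
  "('o, 'm) precat \<Rightarrow> (('o, 'm) invseq, ('o, 'm) invseq \<times> (nat \<Rightarrow> 'm) \<times> ('o, 'm) invseq) precat"
  where
  "invseq_cat C = \<lparr>
    Obj = {S. inverse_sequence C S},
    Arr = {(S, \<phi>, T). inverse_sequence C S \<and> inverse_sequence C T \<and>
      (\<forall>i. \<phi> i \<in> Hom C (ob S i) (ob T i) \<and> \<phi> i \<cdot>\<^bsub>C\<^esub> bond S i = bond T i \<cdot>\<^bsub>C\<^esub> \<phi> (Suc i))},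
    Dom = (\<lambda>(S, \<phi>, T). S),
    Cod = (\<lambda>(S, \<phi>, T). T),
    Ident = (\<lambda>S. (S, \<lambda>i. Ident C (ob S i), S)),
    Comp = (\<lambda>(_, \<psi>, U) (S, \<phi>, _). (S, \<lambda>i. \<psi> i \<cdot>\<^bsub>C\<^esub> \<phi> i, U)),
    Add = (\<lambda>(S, \<phi>, T) (_, \<psi>, _). (S, \<lambda>i. Add C (\<phi> i) (\<psi> i), T)),
    Zero = (\<lambda>S T. (S, \<lambda>i. Zero C (ob S i) (ob T i), T))\<rparr>"

definition epimorphic :: "('o, 'm) precat \<Rightarrow> ('o, 'm) invseq \<Rightarrow> bool" where
  "epimorphic C S \<longleftrightarrow> (\<forall>i. epic C (bond S i))"

text \<open>\<open>d\<close> is \<open>1 - F\<close> on some product of the objects of \<open>S\<close>.\<close>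

definition is_shift_difference :: "('o, 'm) precat \<Rightarrow> ('o, 'm) invseq \<Rightarrow> 'm \<Rightarrow> bool" where
  "is_shift_difference C S d \<longleftrightarrow>
    (\<exists>P pr F. is_product C (UNIV :: nat set) (ob S) P pr \<and> F \<in> Hom C P P \<and>
      (\<forall>j. pr j \<cdot>\<^bsub>C\<^esub> F = bond S j \<cdot>\<^bsub>C\<^esub> pr (Suc j)) \<and> d = Diff C (Ident C P) F)"

definition is_Lim :: "('o, 'm) precat \<Rightarrow> ('o, 'm) invseq \<Rightarrow> 'o \<Rightarrow> bool" where
  "is_Lim C S L \<longleftrightarrow> (\<exists>d k. is_shift_difference C S d \<and> is_kernel C k d \<and> L = Dom C k)"

definition is_Lim1 :: "('o, 'm) precat \<Rightarrow> ('o, 'm) invseq \<Rightarrow> 'o \<Rightarrow> bool" where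
  "is_Lim1 C S L \<longleftrightarrow> (\<exists>d c. is_shift_difference C S d \<and> is_cokernel C c d \<and> L = Cod C c)"

definition Lim_obj :: "('o, 'm) precat \<Rightarrow> ('o, 'm) invseq \<Rightarrow> 'o" where
  "Lim_obj C S = (SOME L. is_Lim C S L)"

definition Lim1_obj :: "('o, 'm) precat \<Rightarrow> ('o, 'm) invseq \<Rightarrow> 'o" where
  "Lim1_obj C S = (SOME L. is_Lim1 C S L)"

definition epi_lim_zero_sequence ::
  "('o, 'm) precat \<Rightarrow> ('o, 'm) invseq
    \<Rightarrow> ('o, 'm) invseq \<times> (nat \<Rightarrow> 'm) \<times> ('o, 'm) invseq
    \<Rightarrow> ('o, 'm) invseq \<times> (nat \<Rightarrow> 'm) \<times> ('o, 'm) invseq \<Rightarrow> bool" where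
  "epi_lim_zero_sequence C S i p \<longleftrightarrow>
    short_exact (invseq_cat C) i p \<and> Cod (invseq_cat C) i = S \<and>
    epimorphic C (Dom (invseq_cat C) i) \<and>
    zero_object C (Lim_obj C (Cod (invseq_cat C) p))"

end

theory Submission
  imports Defs
begin

text \<open>The heart of the matter is that \<open>lim\<^sup>1 E = 0\<close> for epimorphic \<open>E\<close>. Exactness of products yields
  common refinements of small families of epimorphisms, and with a generator \<open>G\<close> there is a single
  epimorphism \<open>p : P \<rightarrow> G\<close> that factors through every epimorphism onto \<open>G\<close>. A well-founded
  induction on finite partial threads shows that, after composition with \<open>p\<close>, every
  \<open>x : G \<rightarrow> E\<^sub>0\<close> extends to a thread, and more generally that the equations
  \<open>y\<^sub>n = f\<^sub>n y\<^sub>n\<^sub>+\<^sub>1 + a\<^sub>n p\<close> are solvable. Hence \<open>1 - F\<close> is epic on \<open>\<Prod> E\<^sub>i\<close>, and every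
  morphism from an epimorphic sequence to a sequence with zero limit vanishes, which gives uniqueness.
  For existence take for \<open>E\<^sub>n\<close> the image of \<open>lim S \<rightarrow> S\<^sub>n\<close>: a thread of \<open>S/E\<close> lifts, after
  passing to a cover, to a thread of \<open>S\<close>, which lies in \<open>E\<close>. Finally \<open>S\<close> and \<open>S/E\<close> have the same
  \<open>lim\<^sup>1\<close> because \<open>1 - F\<close> is epic for \<open>E\<close>.\<close>

section \<open>Categories, kernels and cokernels\<close>

text \<open>The obstacle: a map into \<open>E n\<close> lifts along an epimorphism only after
  passing to a cover, and infinitely many lifting steps give an infinite tower of covers whose limit
  has no reason to be epic. The universal cover fixes one domain \<open>P\<close> in advance, but
  \<open>P\<close> need not be projective: \<open>p\<close> factors through every epimorphism onto
  \<open>G\<close>, while an epimorphism onto \<open>P\<close> need not split, so lifting step by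
  step over \<open>P\<close> may get stuck. This forces an argument by contradiction. If every
  attempt gets stuck, there is something well-founded to induct on; and since the maps out of
  \<open>P\<close> into a fixed object form a small set, one cover can exclude all continuations of
  a partial solution together. The terms \<open>a n\<close> are carried along because solvability
  for arbitrary \<open>a\<close> is the surjectivity of \<open>1 - F\<close>; the case
  \<open>a = 0\<close> yields honest threads.\<close>

lemma short_exactD:
  assumes "short_exact C i p"
  shows "i \<in> Arr C" "p \<in> Arr C" "Cod C i = Dom C p"
  using assms by (auto simp: short_exact_def is_kernel_def)

context category
begin

lemma in_Hom: "f \<in> Hom C a b \<longleftrightarrow> f \<in> Arr C \<and> Dom C f = a \<and> Cod C f = b"
  by (auto simp: Hom_def)

lemma Hom_Obj: "f \<in> Hom C a b \<Longrightarrow> a \<in> Obj C \<and> b \<in> Obj C"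
  using Dom_Obj Cod_Obj by (auto simp: in_Hom)

lemma Comp_Arr [simp]:
  assumes "f \<in> Arr C" "g \<in> Arr C" "Dom C g = Cod C f"
  shows "g \<cdot> f \<in> Arr C" "Dom C (g \<cdot> f) = Dom C f" "Cod C (g \<cdot> f) = Cod C g"
  using Comp_Hom[of f "Dom C f" "Cod C f" g "Cod C g"] assms by (auto simp: in_Hom)

lemma Ident_Arr [simp]:
  assumes "a \<in> Obj C"
  shows "Ident C a \<in> Arr C" "Dom C (Ident C a) = a" "Cod C (Ident C a) = a"
  using Ident_Hom[OF assms] by (auto simp: in_Hom)

lemma Comp_Ident_Arr [simp]: "\<lbrakk>f \<in> Arr C; Dom C f = a\<rbrakk> \<Longrightarrow> f \<cdot> Ident C a = f"
  using Comp_Ident[of f a "Cod C f"] by (auto simp: in_Hom)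

lemma Ident_Comp_Arr [simp]: "\<lbrakk>f \<in> Arr C; Cod C f = b\<rbrakk> \<Longrightarrow> Ident C b \<cdot> f = f"
  using Ident_Comp[of f "Dom C f" b] by (auto simp: in_Hom)

lemma Comp_assoc_Arr [simp]:
  "\<lbrakk>f \<in> Arr C; g \<in> Arr C; h \<in> Arr C; Dom C g = Cod C f; Dom C h = Cod C g\<rbrakk>
    \<Longrightarrow> (h \<cdot> g) \<cdot> f = h \<cdot> (g \<cdot> f)"
  using Comp_assoc[of f "Dom C f" "Cod C f" g "Cod C g" h "Cod C h"] by (auto simp: in_Hom)

lemma monicD:
  "\<lbrakk>monic C f; g \<in> Hom C a (Dom C f); h \<in> Hom C a (Dom C f); f \<cdot> g = f \<cdot> h\<rbrakk> \<Longrightarrow> g = h"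
  using Hom_Obj unfolding monic_def by blast

lemma epicD:
  "\<lbrakk>epic C f; g \<in> Hom C (Cod C f) b; h \<in> Hom C (Cod C f) b; g \<cdot> f = h \<cdot> f\<rbrakk> \<Longrightarrow> g = h"
  using Hom_Obj unfolding epic_def by blast

lemma monic_Comp:
  assumes "monic C f" "monic C g" "Dom C g = Cod C f"
  shows "monic C (g \<cdot> f)"
proof -
  have Arr: "f \<in> Arr C" "g \<in> Arr C"
    using assms by (auto simp: monic_def)
  show ?thesis
    unfolding monic_def
  proof (intro conjI ballI impI)
    fix a h k
    assume h: "h \<in> Hom C a (Dom C (g \<cdot> f))" and k: "k \<in> Hom C a (Dom C (g \<cdot> f))"
      and "g \<cdot> f \<cdot> h = g \<cdot> f \<cdot> k"
    then have "g \<cdot> (f \<cdot> h) = g \<cdot> (f \<cdot> k)"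
      using Arr assms(3) by (simp add: in_Hom)
    then have "f \<cdot> h = f \<cdot> k"
      using monicD[OF assms(2), of "f \<cdot> h" a "f \<cdot> k"] Arr assms(3) h k by (simp add: in_Hom)
    then show "h = k"
      using monicD[OF assms(1), of h a k] Arr assms(3) h k by simp
  qed (use Arr assms in simp)
qed

lemma epic_Comp:
  assumes "epic C f" "epic C g" "Dom C g = Cod C f"
  shows "epic C (g \<cdot> f)"
proof -
  have Arr: "f \<in> Arr C" "g \<in> Arr C"
    using assms by (auto simp: epic_def)
  show ?thesis
    unfolding epic_def
  proof (intro conjI ballI impI)
    fix b h k
    assume h: "h \<in> Hom C (Cod C (g \<cdot> f)) b" and k: "k \<in> Hom C (Cod C (g \<cdot> f)) b"
      and "h \<cdot> (g \<cdot> f) = k \<cdot> (g \<cdot> f)"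
    then have "(h \<cdot> g) \<cdot> f = (k \<cdot> g) \<cdot> f"
      using Arr assms(3) by (simp add: in_Hom)
    then have "h \<cdot> g = k \<cdot> g"
      using epicD[OF assms(1), of "h \<cdot> g" b "k \<cdot> g"] Arr assms(3) h k by (simp add: in_Hom)
    then show "h = k"
      using epicD[OF assms(2), of h b k] Arr assms(3) h k by simp
  qed (use Arr assms in simp)
qed

lemma epic_cancel:
  assumes "epic C (g \<cdot> f)" "f \<in> Arr C" "g \<in> Arr C" "Dom C g = Cod C f"
  shows "epic C g"
  unfolding epic_def
proof (intro conjI ballI impI)
  fix b h k
  assume h: "h \<in> Hom C (Cod C g) b" and k: "k \<in> Hom C (Cod C g) b" and "h \<cdot> g = k \<cdot> g"
  then have "(h \<cdot> g) \<cdot> f = (k \<cdot> g) \<cdot> f"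
    by simp
  then show "h = k"
    using epicD[OF assms(1), of h b k] assms h k by (simp add: in_Hom)
qed (use assms in simp)

lemma isomorphism_epic:
  assumes "isomorphism C f"
  shows "epic C f"
proof -
  obtain g where g: "f \<in> Arr C" "g \<in> Hom C (Cod C f) (Dom C f)" "f \<cdot> g = Ident C (Cod C f)"
    using assms by (auto simp: isomorphism_def)
  have "epic C (Ident C (Cod C f))"
    using g Cod_Obj by (auto simp: epic_def in_Hom)
  then show ?thesis
    using epic_cancel[of f g] g by (auto simp: in_Hom)
qed

lemma kernel_factor:
  assumes "is_kernel C k f" "g \<in> Hom C a (Dom C f)" "f \<cdot> g = Zero C a (Cod C f)"
  obtains u where "u \<in> Hom C a (Dom C k)" "k \<cdot> u = g"
  using assms Hom_Obj unfolding is_kernel_def by blast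

lemma cokernel_factor:
  assumes "is_cokernel C c f" "g \<in> Hom C (Cod C f) b" "g \<cdot> f = Zero C (Dom C f) b"
  obtains u where "u \<in> Hom C (Cod C c) b" "u \<cdot> c = g"
  using assms Hom_Obj unfolding is_cokernel_def by blast

lemma is_kernelI:
  assumes "k \<in> Arr C" "f \<in> Arr C" "Cod C k = Dom C f" "f \<cdot> k = Zero C (Dom C k) (Cod C f)"
    and "monic C k"
    and "\<And>a g. \<lbrakk>g \<in> Hom C a (Dom C f); f \<cdot> g = Zero C a (Cod C f)\<rbrakk>
      \<Longrightarrow> \<exists>u \<in> Hom C a (Dom C k). k \<cdot> u = g"
  shows "is_kernel C k f"
  unfolding is_kernel_def using assms monicD[OF assms(5)] by blast

lemma is_cokernelI:
  assumes "c \<in> Arr C" "f \<in> Arr C" "Dom C c = Cod C f" "c \<cdot> f = Zero C (Dom C f) (Cod C c)"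
    and "epic C c"
    and "\<And>b g. \<lbrakk>g \<in> Hom C (Cod C f) b; g \<cdot> f = Zero C (Dom C f) b\<rbrakk>
      \<Longrightarrow> \<exists>u \<in> Hom C (Cod C c) b. u \<cdot> c = g"
  shows "is_cokernel C c f"
  unfolding is_cokernel_def using assms epicD[OF assms(5)] by blast

text \<open>The zero composites let each kernel factor through the other, and likewise the
  cokernels. The setting is a bare \<open>category\<close> because the lemma is applied to
  \<open>invseq_cat C\<close>, for which only the category axioms get proved.\<close>

lemma short_exact_unique:
  assumes ip: "short_exact C i p" and ip': "short_exact C i' p'" and "Cod C i = Cod C i'"
    and z: "p' \<cdot> i = Zero C (Dom C i) (Cod C p')" and z': "p \<cdot> i' = Zero C (Dom C i') (Cod C p)"
  shows "\<exists>\<phi> \<psi>. \<phi> \<in> Hom C (Dom C i) (Dom C i') \<and> isomorphism C \<phi> \<and>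
    \<psi> \<in> Hom C (Cod C p) (Cod C p') \<and> isomorphism C \<psi> \<and> i' \<cdot> \<phi> = i \<and> \<psi> \<cdot> p = p'"
proof -
  have kernel: "\<exists>\<phi> \<in> Hom C (Dom C i) (Dom C i'). i' \<cdot> \<phi> = i \<and> isomorphism C \<phi>"
    if k: "is_kernel C i p" "is_kernel C i' p'" "Cod C i = Cod C i'"
      "p' \<cdot> i = Zero C (Dom C i) (Cod C p')" "p \<cdot> i' = Zero C (Dom C i') (Cod C p)"
    for i p i' p'
  proof -
    have A: "i \<in> Arr C" "p \<in> Arr C" "Cod C i = Dom C p" "i' \<in> Arr C" "p' \<in> Arr C" "Cod C i' = Dom C p'"
      using that by (auto simp: is_kernel_def)
    \<comment> \<open>Here \<open>Zero\<close> obeys no laws, so a kernel cannot be shown to be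
      monic. The uniqueness clause for factoring \<open>i\<close> through itself takes the place of
      cancellation.\<close>
    have inj: "u = Ident C (Dom C i)"
      if "is_kernel C i p" "u \<in> Hom C (Dom C i) (Dom C i)" "i \<cdot> u = i" for u i p
    proof -
      have "i \<in> Hom C (Dom C i) (Dom C p)" "p \<cdot> i = Zero C (Dom C i) (Cod C p)" "Dom C i \<in> Obj C"
        using that Dom_Obj by (auto simp: is_kernel_def in_Hom)
      then have "\<exists>!u. u \<in> Hom C (Dom C i) (Dom C i) \<and> i \<cdot> u = i"
        using that(1) unfolding is_kernel_def by blast
      then show ?thesis
        using that(2,3) \<open>Dom C i \<in> Obj C\<close> \<open>i \<in> _\<close> by (metis Ident_Hom Comp_Ident)
    qed
    obtain u where u: "u \<in> Hom C (Dom C i) (Dom C i')" "i' \<cdot> u = i"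
      using kernel_factor[OF k(2), of i "Dom C i"] k A by (auto simp: in_Hom)
    obtain v where v: "v \<in> Hom C (Dom C i') (Dom C i)" "i \<cdot> v = i'"
      using kernel_factor[OF k(1), of i' "Dom C i'"] k A by (auto simp: in_Hom)
    have "i \<cdot> (v \<cdot> u) = (i \<cdot> v) \<cdot> u" "i' \<cdot> (u \<cdot> v) = (i' \<cdot> u) \<cdot> v"
      using A u(1) v(1) by (simp_all add: in_Hom)
    then have "v \<cdot> u = Ident C (Dom C i)" "u \<cdot> v = Ident C (Dom C i')"
      using u v inj[OF k(1), of "v \<cdot> u"] inj[OF k(2), of "u \<cdot> v"] Comp_Hom by metis+
    then show ?thesis
      using u v by (intro bexI[of _ u]) (auto simp: isomorphism_def in_Hom)
  qed
  have cokernel: "\<exists>\<psi> \<in> Hom C (Cod C p) (Cod C p'). \<psi> \<cdot> p = p' \<and> isomorphism C \<psi>"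
    if k: "is_cokernel C p i" "is_cokernel C p' i'" "Cod C i = Cod C i'"
      "p' \<cdot> i = Zero C (Dom C i) (Cod C p')" "p \<cdot> i' = Zero C (Dom C i') (Cod C p)"
    for i p i' p'
  proof -
    have A: "i \<in> Arr C" "p \<in> Arr C" "Cod C i = Dom C p" "i' \<in> Arr C" "p' \<in> Arr C" "Cod C i' = Dom C p'"
      using that by (auto simp: is_cokernel_def)
    have inj: "u = Ident C (Cod C p)"
      if "is_cokernel C p i" "u \<in> Hom C (Cod C p) (Cod C p)" "u \<cdot> p = p" for u i p
    proof -
      have "p \<in> Hom C (Cod C i) (Cod C p)" "p \<cdot> i = Zero C (Dom C i) (Cod C p)" "Cod C p \<in> Obj C"
        using that Cod_Obj by (auto simp: is_cokernel_def in_Hom)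
      then have "\<exists>!u. u \<in> Hom C (Cod C p) (Cod C p) \<and> u \<cdot> p = p"
        using that(1) unfolding is_cokernel_def by blast
      then show ?thesis
        using that(2,3) \<open>Cod C p \<in> Obj C\<close> \<open>p \<in> _\<close> by (metis Ident_Hom Ident_Comp)
    qed
    obtain u where u: "u \<in> Hom C (Cod C p) (Cod C p')" "u \<cdot> p = p'"
      using cokernel_factor[OF k(1), of p' "Cod C p'"] k A by (auto simp: in_Hom)
    obtain v where v: "v \<in> Hom C (Cod C p') (Cod C p)" "v \<cdot> p' = p"
      using cokernel_factor[OF k(2), of p "Cod C p"] k A by (auto simp: in_Hom)
    have "(v \<cdot> u) \<cdot> p = v \<cdot> (u \<cdot> p)" "(u \<cdot> v) \<cdot> p' = u \<cdot> (v \<cdot> p')"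
      using A u(1) v(1) by (simp_all add: in_Hom)
    then have "v \<cdot> u = Ident C (Cod C p)" "u \<cdot> v = Ident C (Cod C p')"
      using u v inj[OF k(1), of "v \<cdot> u"] inj[OF k(2), of "u \<cdot> v"] Comp_Hom by metis+
    then show ?thesis
      using u v by (intro bexI[of _ u]) (auto simp: isomorphism_def in_Hom)
  qed
  show ?thesis
    using kernel[of i p i' p'] cokernel[of p i p' i'] assms unfolding short_exact_def by blast
qed

section \<open>Universal properties of products and coproducts\<close>

lemma product_map:
  assumes "is_product C I X P pr" "\<And>i. i \<in> I \<Longrightarrow> q i \<in> Hom C Q (X i)" "Q \<in> Obj C"
  obtains u where "u \<in> Hom C Q P" "\<And>i. i \<in> I \<Longrightarrow> pr i \<cdot> u = q i"
  using assms unfolding is_product_def by metis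

lemma product_eqI:
  assumes "is_product C I X P pr" "u \<in> Hom C Q P" "v \<in> Hom C Q P"
    and "\<And>i. i \<in> I \<Longrightarrow> pr i \<cdot> u = pr i \<cdot> v"
  shows "u = v"
proof -
  have "\<And>i. i \<in> I \<Longrightarrow> pr i \<cdot> v \<in> Hom C Q (X i)"
    using assms(1,3) unfolding is_product_def by (auto simp: in_Hom)
  then have "\<exists>!u. u \<in> Hom C Q P \<and> (\<forall>i \<in> I. pr i \<cdot> u = pr i \<cdot> v)"
    using assms(1) Hom_Obj[OF assms(2)] unfolding is_product_def
    by (elim conjE ballE[of _ _ Q] allE[of _ "\<lambda>i. pr i \<cdot> v"]) auto
  then show ?thesis
    using assms by blast
qed

lemma coproduct_map:
  assumes "is_coproduct C I X P \<iota>" "\<And>i. i \<in> I \<Longrightarrow> q i \<in> Hom C (X i) Q" "Q \<in> Obj C"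
  obtains u where "u \<in> Hom C P Q" "\<And>i. i \<in> I \<Longrightarrow> u \<cdot> \<iota> i = q i"
  using assms unfolding is_coproduct_def by metis

lemma coproduct_eqI:
  assumes "is_coproduct C I X P \<iota>" "u \<in> Hom C P Q" "v \<in> Hom C P Q"
    and "\<And>i. i \<in> I \<Longrightarrow> u \<cdot> \<iota> i = v \<cdot> \<iota> i"
  shows "u = v"
proof -
  have "\<And>i. i \<in> I \<Longrightarrow> v \<cdot> \<iota> i \<in> Hom C (X i) Q"
    using assms(1,3) unfolding is_coproduct_def by (auto simp: in_Hom)
  then have "\<exists>!u. u \<in> Hom C P Q \<and> (\<forall>i \<in> I. u \<cdot> \<iota> i = v \<cdot> \<iota> i)"
    using assms(1) Hom_Obj[OF assms(2)] unfolding is_coproduct_def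
    by (elim conjE ballE[of _ _ Q] allE[of _ "\<lambda>i. v \<cdot> \<iota> i"]) auto
  then show ?thesis
    using assms by blast
qed

text \<open>The hypotheses on small products speak only of index sets of type \<open>'k set\<close>.
  This transports products to index sets of other types, such as the natural numbers or a set of
  arrows.\<close>

lemma is_product_reindex:
  assumes "bij_betw e A B" "is_product C B X P pr"
    and eq: "\<And>j. j \<in> A \<Longrightarrow> Y j = X (e j)" "\<And>j. j \<in> A \<Longrightarrow> pr' j = pr (e j)"
  shows "is_product C A Y P pr'"
  unfolding is_product_def
proof (intro conjI ballI allI impI)
  define g where "g = inv_into A e"
  have e: "\<And>j. j \<in> A \<Longrightarrow> e j \<in> B \<and> g (e j) = j" and g: "\<And>b. b \<in> B \<Longrightarrow> g b \<in> A \<and> e (g b) = b"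
    using assms(1) unfolding g_def
    by (auto simp: bij_betw_def inv_into_into f_inv_into_f)
  show "P \<in> Obj C" "\<And>j. j \<in> A \<Longrightarrow> pr' j \<in> Hom C P (Y j)"
    using assms(2) e eq by (auto simp: is_product_def)
  fix Q q assume Q: "Q \<in> Obj C" and q: "\<forall>i\<in>A. q i \<in> Hom C Q (Y i)"
  have "\<forall>b\<in>B. q (g b) \<in> Hom C Q (X b)"
    using q g eq(1) by metis
  then have *: "\<exists>!u. u \<in> Hom C Q P \<and> (\<forall>b \<in> B. pr b \<cdot> u = q (g b))"
    using assms(2) Q unfolding is_product_def
    by (elim conjE ballE[of _ _ Q] allE[of _ "\<lambda>b. q (g b)"]) auto
  have "(\<forall>b \<in> B. pr b \<cdot> u = q (g b)) \<longleftrightarrow> (\<forall>i \<in> A. pr' i \<cdot> u = q i)" for u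
    using e g eq by metis
  then show "\<exists>!u. u \<in> Hom C Q P \<and> (\<forall>i \<in> A. pr' i \<cdot> u = q i)"
    using * by simp
qed

lemma is_coproduct_reindex:
  assumes "bij_betw e A B" "is_coproduct C B X P \<iota>"
    and eq: "\<And>j. j \<in> A \<Longrightarrow> Y j = X (e j)" "\<And>j. j \<in> A \<Longrightarrow> \<iota>' j = \<iota> (e j)"
  shows "is_coproduct C A Y P \<iota>'"
  unfolding is_coproduct_def
proof (intro conjI ballI allI impI)
  define g where "g = inv_into A e"
  have e: "\<And>j. j \<in> A \<Longrightarrow> e j \<in> B \<and> g (e j) = j" and g: "\<And>b. b \<in> B \<Longrightarrow> g b \<in> A \<and> e (g b) = b"
    using assms(1) unfolding g_def
    by (auto simp: bij_betw_def inv_into_into f_inv_into_f)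
  show "P \<in> Obj C" "\<And>j. j \<in> A \<Longrightarrow> \<iota>' j \<in> Hom C (Y j) P"
    using assms(2) e eq by (auto simp: is_coproduct_def)
  fix Q q assume Q: "Q \<in> Obj C" and q: "\<forall>i\<in>A. q i \<in> Hom C (Y i) Q"
  have "\<forall>b\<in>B. q (g b) \<in> Hom C (X b) Q"
    using q g eq(1) by metis
  then have *: "\<exists>!u. u \<in> Hom C P Q \<and> (\<forall>b \<in> B. u \<cdot> \<iota> b = q (g b))"
    using assms(2) Q unfolding is_coproduct_def
    by (elim conjE ballE[of _ _ Q] allE[of _ "\<lambda>b. q (g b)"]) auto
  have "(\<forall>b \<in> B. u \<cdot> \<iota> b = q (g b)) \<longleftrightarrow> (\<forall>i \<in> A. u \<cdot> \<iota>' i = q i)" for u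
    using e g eq by metis
  then show "\<exists>!u. u \<in> Hom C P Q \<and> (\<forall>i \<in> A. u \<cdot> \<iota>' i = q i)"
    using * by simp
qed

end

section \<open>Calculus of sums, differences and zero morphisms\<close>

context preadditive_category
begin

definition neg :: "'b \<Rightarrow> 'b" where
  "neg f = inv\<^bsub>hom_group C (Dom C f) (Cod C f)\<^esub> f"

lemma Zero_Arr [simp]:
  assumes "a \<in> Obj C" "b \<in> Obj C"
  shows "Zero C a b \<in> Arr C" "Dom C (Zero C a b) = a" "Cod C (Zero C a b) = b"
proof -
  interpret comm_group "hom_group C a b" using hom_comm_group assms .
  show "Zero C a b \<in> Arr C" "Dom C (Zero C a b) = a" "Cod C (Zero C a b) = b"
    using one_closed by (auto simp: hom_group_def in_Hom)
qed

lemma Add_Hom: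
  assumes "f \<in> Hom C a b" "g \<in> Hom C a b"
  shows "Add C f g \<in> Hom C a b"
proof -
  interpret comm_group "hom_group C a b" using hom_comm_group Hom_Obj[OF assms(1)] by blast
  show ?thesis using m_closed[of f g] assms by (auto simp: hom_group_def)
qed

lemma Add_Arr [simp]:
  assumes "f \<in> Arr C" "g \<in> Arr C" "Dom C f = Dom C g" "Cod C f = Cod C g"
  shows "Add C f g \<in> Arr C" "Dom C (Add C f g) = Dom C g" "Cod C (Add C f g) = Cod C g"
  using Add_Hom[of f "Dom C g" "Cod C g" g] assms by (auto simp: in_Hom)

lemma neg_Arr [simp]:
  assumes "f \<in> Arr C"
  shows "neg f \<in> Arr C" "Dom C (neg f) = Dom C f" "Cod C (neg f) = Cod C f"
proof -
  interpret comm_group "hom_group C (Dom C f) (Cod C f)"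
    using hom_comm_group Dom_Obj Cod_Obj assms by blast
  have "neg f \<in> Hom C (Dom C f) (Cod C f)"
    using inv_closed[of f] assms by (auto simp: hom_group_def neg_def in_Hom)
  then show "neg f \<in> Arr C" "Dom C (neg f) = Dom C f" "Cod C (neg f) = Cod C f"
    by (auto simp: in_Hom)
qed

lemma Diff_eq: "Diff C f g = Add C f (neg g)"
  by (simp add: Diff_def neg_def)

lemma Diff_Arr [simp]:
  assumes "f \<in> Arr C" "g \<in> Arr C" "Dom C f = Dom C g" "Cod C f = Cod C g"
  shows "Diff C f g \<in> Arr C" "Dom C (Diff C f g) = Dom C g" "Cod C (Diff C f g) = Cod C g"
  using assms by (auto simp: Diff_eq)

text \<open>The axioms make composition distribute over \<open>Add\<close> only; moving the
  subtrahend to the other side carries this over to \<open>Diff\<close>.\<close>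

lemma Diff_eq_iff:
  assumes "f \<in> Arr C" "g \<in> Arr C" "h \<in> Arr C" "Dom C f = Dom C g" "Cod C f = Cod C g"
    "Dom C h = Dom C g" "Cod C h = Cod C g"
  shows "Diff C f g = h \<longleftrightarrow> f = Add C h g"
proof -
  interpret comm_group "hom_group C (Dom C g) (Cod C g)"
    using hom_comm_group Dom_Obj Cod_Obj assms by blast
  show ?thesis
    using inv_solve_right[of h f g] assms
    by (auto simp: hom_group_def Diff_def in_Hom)
qed

lemma Add_Zero [simp]:
  assumes "f \<in> Arr C" "Dom C f = a" "Cod C f = b"
  shows "Add C f (Zero C a b) = f" "Add C (Zero C a b) f = f"
proof -
  interpret comm_group "hom_group C a b"
    using hom_comm_group Dom_Obj Cod_Obj assms by blast
  show "Add C f (Zero C a b) = f" "Add C (Zero C a b) f = f"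
    using r_one[of f] l_one[of f] assms by (auto simp: hom_group_def in_Hom)
qed

lemma Diff_eq_Zero_iff:
  assumes "f \<in> Arr C" "g \<in> Arr C" "Dom C f = Dom C g" "Cod C f = Cod C g"
  shows "Diff C f g = Zero C (Dom C g) (Cod C g) \<longleftrightarrow> f = g"
  using assms Diff_eq_iff[of f g "Zero C (Dom C g) (Cod C g)"] Dom_Obj Cod_Obj by simp

lemma Add_commute:
  assumes "f \<in> Arr C" "g \<in> Arr C" "Dom C f = Dom C g" "Cod C f = Cod C g"
  shows "Add C f g = Add C g f"
proof -
  interpret comm_group "hom_group C (Dom C g) (Cod C g)"
    using hom_comm_group Dom_Obj Cod_Obj assms by blast
  show ?thesis
    using m_comm[of f g] assms by (simp add: hom_group_def in_Hom)
qed

text \<open>Serves to compute the defect \<open>y n - f y (Suc n)\<close> of a difference of two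
  families as the difference of their defects.\<close>

lemma Diff_Diff_swap:
  assumes "f \<in> Hom C a b" "g \<in> Hom C a b" "h \<in> Hom C a b" "k \<in> Hom C a b"
  shows "Diff C (Diff C f g) (Diff C h k) = Diff C (Diff C f h) (Diff C g k)"
proof -
  interpret comm_group "hom_group C a b"
    using hom_comm_group Hom_Obj[OF assms(1)] by blast
  have D: "Diff C u v = u \<otimes>\<^bsub>hom_group C a b\<^esub> inv\<^bsub>hom_group C a b\<^esub> v" if "v \<in> Hom C a b" for u v
    using that by (simp add: Diff_def hom_group_def in_Hom)
  have c: "carrier (hom_group C a b) = Hom C a b"
    by (simp add: hom_group_def)
  have "Diff C h k \<in> Hom C a b" "Diff C g k \<in> Hom C a b"
    using assms by (simp_all add: in_Hom)
  then show ?thesis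
    using assms by (simp add: D) (simp add: c[symmetric] inv_mult m_ac)
qed

text \<open>Bilinearity makes a composite with a zero morphism idempotent for \<open>Add\<close>; in
  a group this forces it to be zero.\<close>

lemma Add_idem_Zero:
  assumes "f \<in> Arr C" "Add C f f = f"
  shows "f = Zero C (Dom C f) (Cod C f)"
  using Diff_eq_iff[of f f f] Diff_eq_Zero_iff[of f f] assms by simp

lemma Comp_Zero [simp]:
  assumes "f \<in> Arr C" "Dom C f = b" "a \<in> Obj C"
  shows "f \<cdot> Zero C a b = Zero C a (Cod C f)"
proof -
  have b: "b \<in> Obj C" using assms Dom_Obj by blast
  have "f \<cdot> Add C (Zero C a b) (Zero C a b) = Add C (f \<cdot> Zero C a b) (f \<cdot> Zero C a b)"
    using Comp_Add_right[of "Zero C a b" a b "Zero C a b" f "Cod C f"] assms b by (simp add: in_Hom)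
  then show ?thesis
    using Add_idem_Zero[of "f \<cdot> Zero C a b"] assms b by simp
qed

lemma Zero_Comp [simp]:
  assumes "f \<in> Arr C" "Cod C f = b" "c \<in> Obj C"
  shows "Zero C b c \<cdot> f = Zero C (Dom C f) c"
proof -
  have b: "b \<in> Obj C" using assms Cod_Obj by blast
  have "Add C (Zero C b c) (Zero C b c) \<cdot> f = Add C (Zero C b c \<cdot> f) (Zero C b c \<cdot> f)"
    using Comp_Add_left[of f "Dom C f" b "Zero C b c" c "Zero C b c"] assms b by (simp add: in_Hom)
  then show ?thesis
    using Add_idem_Zero[of "Zero C b c \<cdot> f"] assms b by simp
qed

lemma Comp_Add_Arr:
  assumes "f \<in> Arr C" "g \<in> Arr C" "h \<in> Arr C" "Dom C f = Dom C g" "Cod C f = Cod C g"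
    "Dom C h = Cod C g"
  shows "h \<cdot> Add C f g = Add C (h \<cdot> f) (h \<cdot> g)"
  using Comp_Add_right[of f "Dom C g" "Cod C g" g h "Cod C h"] assms by (simp add: in_Hom)

lemma Add_Comp_Arr:
  assumes "f \<in> Arr C" "g \<in> Arr C" "h \<in> Arr C" "Dom C f = Dom C g" "Cod C f = Cod C g"
    "Dom C g = Cod C h"
  shows "Add C f g \<cdot> h = Add C (f \<cdot> h) (g \<cdot> h)"
  using Comp_Add_left[of h "Dom C h" "Cod C h" f "Cod C g" g] assms by (simp add: in_Hom)

lemma Comp_Diff:
  assumes "f \<in> Arr C" "g \<in> Arr C" "h \<in> Arr C" "Dom C f = Dom C g" "Cod C f = Cod C g"
    "Dom C h = Cod C g"
  shows "h \<cdot> Diff C f g = Diff C (h \<cdot> f) (h \<cdot> g)"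
proof -
  have "f = Add C (Diff C f g) g"
    using Diff_eq_iff[of f g "Diff C f g"] assms by simp
  then have "h \<cdot> f = Add C (h \<cdot> Diff C f g) (h \<cdot> g)"
    using Comp_Add_Arr[of "Diff C f g" g h] assms by simp
  then show ?thesis
    using Diff_eq_iff[of "h \<cdot> f" "h \<cdot> g" "h \<cdot> Diff C f g"] assms by simp
qed

lemma Diff_Comp:
  assumes "f \<in> Arr C" "g \<in> Arr C" "h \<in> Arr C" "Dom C f = Dom C g" "Cod C f = Cod C g"
    "Dom C g = Cod C h"
  shows "Diff C f g \<cdot> h = Diff C (f \<cdot> h) (g \<cdot> h)"
proof -
  have "f = Add C (Diff C f g) g"
    using Diff_eq_iff[of f g "Diff C f g"] assms by simp
  then have "f \<cdot> h = Add C (Diff C f g \<cdot> h) (g \<cdot> h)"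
    using Add_Comp_Arr[of "Diff C f g" g h] assms by simp
  then show ?thesis
    using Diff_eq_iff[of "f \<cdot> h" "g \<cdot> h" "Diff C f g \<cdot> h"] assms by simp
qed

lemma epicI_zero:
  assumes "f \<in> Arr C"
    and "\<And>b r. \<lbrakk>r \<in> Hom C (Cod C f) b; r \<cdot> f = Zero C (Dom C f) b\<rbrakk> \<Longrightarrow> r = Zero C (Cod C f) b"
  shows "epic C f"
  unfolding epic_def
proof (intro conjI ballI impI)
  fix b g h
  assume g: "g \<in> Hom C (Cod C f) b" and h: "h \<in> Hom C (Cod C f) b" and eq: "g \<cdot> f = h \<cdot> f"
  have "Diff C g h \<cdot> f = Zero C (Dom C f) b"
    using Diff_Comp[of g h f] Diff_eq_Zero_iff[of "g \<cdot> f" "h \<cdot> f"] assms g h eq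
    by (simp add: in_Hom)
  then have "Diff C g h = Zero C (Cod C f) b"
    using assms(2)[of "Diff C g h" b] g h by (simp add: in_Hom)
  then show "g = h"
    using Diff_eq_Zero_iff[of g h] g h by (simp add: in_Hom)
qed (rule assms)

lemma epic_zeroD:
  assumes "epic C f" "r \<in> Hom C (Cod C f) b" "r \<cdot> f = Zero C (Dom C f) b"
  shows "r = Zero C (Cod C f) b"
  using epicD[OF assms(1,2), of "Zero C (Cod C f) b"] assms Hom_Obj[OF assms(2)]
  by (simp add: in_Hom epic_def)

lemma kernel_monic:
  assumes "is_kernel C k f"
  shows "monic C k"
  unfolding monic_def
proof (intro conjI ballI impI)
  show "k \<in> Arr C" using assms by (simp add: is_kernel_def)
  fix a g h
  assume a: "a \<in> Obj C" and g: "g \<in> Hom C a (Dom C k)" and h: "h \<in> Hom C a (Dom C k)"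
    and eq: "k \<cdot> g = k \<cdot> h"
  have k: "k \<in> Arr C" "f \<in> Arr C" "Cod C k = Dom C f" "f \<cdot> k = Zero C (Dom C k) (Cod C f)"
    using assms by (auto simp: is_kernel_def)
  have "f \<cdot> (k \<cdot> h) = (f \<cdot> k) \<cdot> h"
    using k(1-3) h by (simp add: in_Hom)
  also have "\<dots> = Zero C a (Cod C f)"
    using k h Cod_Obj by (simp add: in_Hom)
  finally have "\<exists>!u. u \<in> Hom C a (Dom C k) \<and> k \<cdot> u = k \<cdot> h"
    using assms a k h unfolding is_kernel_def by (simp add: in_Hom)
  then show "g = h" using g h eq by blast
qed

lemma cokernel_epic:
  assumes "is_cokernel C c f"
  shows "epic C c"
  unfolding epic_def
proof (intro conjI ballI impI)
  show "c \<in> Arr C" using assms by (simp add: is_cokernel_def)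
  fix b g h
  assume b: "b \<in> Obj C" and g: "g \<in> Hom C (Cod C c) b" and h: "h \<in> Hom C (Cod C c) b"
    and eq: "g \<cdot> c = h \<cdot> c"
  have c: "c \<in> Arr C" "f \<in> Arr C" "Dom C c = Cod C f" "c \<cdot> f = Zero C (Dom C f) (Cod C c)"
    using assms by (auto simp: is_cokernel_def)
  have "(h \<cdot> c) \<cdot> f = Zero C (Dom C f) b"
    using c h Dom_Obj by (simp add: in_Hom)
  then have "\<exists>!u. u \<in> Hom C (Cod C c) b \<and> u \<cdot> c = h \<cdot> c"
    using assms b c h unfolding is_cokernel_def by (simp add: in_Hom)
  then show "g = h" using g h eq by blast
qed

lemma cokernels_isomorphic:
  assumes "is_cokernel C c f" "is_cokernel C c' f"
  shows "isomorphic C (Cod C c) (Cod C c')"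
proof -
  have c: "c \<in> Arr C" "Dom C c = Cod C f" "c \<cdot> f = Zero C (Dom C f) (Cod C c)"
    "c' \<in> Arr C" "Dom C c' = Cod C f" "c' \<cdot> f = Zero C (Dom C f) (Cod C c')"
    using assms by (auto simp: is_cokernel_def)
  obtain u where u: "u \<in> Hom C (Cod C c) (Cod C c')" "u \<cdot> c = c'"
    using cokernel_factor[OF assms(1), of c' "Cod C c'"] c by (auto simp: in_Hom)
  obtain v where v: "v \<in> Hom C (Cod C c') (Cod C c)" "v \<cdot> c' = c"
    using cokernel_factor[OF assms(2), of c "Cod C c"] c by (auto simp: in_Hom)
  have "(v \<cdot> u) \<cdot> c = v \<cdot> (u \<cdot> c)" "(u \<cdot> v) \<cdot> c' = u \<cdot> (v \<cdot> c')"
    using c u(1) v(1) by (simp_all add: in_Hom)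
  then have "v \<cdot> u = Ident C (Cod C c)" "u \<cdot> v = Ident C (Cod C c')"
    using epicD[OF cokernel_epic[OF assms(1)], of "v \<cdot> u" "Cod C c" "Ident C (Cod C c)"]
      epicD[OF cokernel_epic[OF assms(2)], of "u \<cdot> v" "Cod C c'" "Ident C (Cod C c')"]
      u v c Cod_Obj by (simp_all add: in_Hom)
  then show ?thesis
    using u(1) v(1) unfolding isomorphic_def isomorphism_def by (metis in_Hom)
qed

text \<open>Carries componentwise exactness from the constructed quotient sequence to any isomorphic
  one.\<close>

lemma short_exact_Comp_isomorphism:
  assumes "short_exact C i p" "isomorphism C \<psi>" "Dom C \<psi> = Cod C p"
  shows "short_exact C i (\<psi> \<cdot> p)"
proof -
  have ip: "is_kernel C i p" "is_cokernel C p i" and psi: "\<psi> \<in> Arr C"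
    using assms by (auto simp: short_exact_def isomorphism_def)
  then have A: "i \<in> Arr C" "p \<in> Arr C" "Cod C i = Dom C p" "p \<cdot> i = Zero C (Dom C i) (Cod C p)"
    by (auto simp: is_kernel_def)
  obtain \<chi> where chi: "\<chi> \<in> Hom C (Cod C \<psi>) (Dom C \<psi>)" "\<chi> \<cdot> \<psi> = Ident C (Dom C \<psi>)"
    using assms by (auto simp: isomorphism_def)
  have zero: "\<psi> \<cdot> p \<cdot> i = Zero C (Dom C i) (Cod C \<psi>)"
    using A psi assms(3) Dom_Obj by simp
  have "is_kernel C i (\<psi> \<cdot> p)"
  proof (rule is_kernelI)
    fix a g assume g: "g \<in> Hom C a (Dom C (\<psi> \<cdot> p))" "\<psi> \<cdot> p \<cdot> g = Zero C a (Cod C (\<psi> \<cdot> p))"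
    have a: "a \<in> Obj C" using g Hom_Obj by blast
    have "p \<cdot> g = (\<chi> \<cdot> \<psi>) \<cdot> (p \<cdot> g)"
      using chi(2) assms(3) psi A g by (simp add: in_Hom)
    also have "\<dots> = \<chi> \<cdot> (\<psi> \<cdot> p \<cdot> g)"
      using chi(1) assms(3) psi A g(1) by (simp add: in_Hom)
    also have "\<dots> = Zero C a (Cod C p)"
      unfolding g(2) using chi(1) assms(3) psi A(1,2) a by (simp add: in_Hom)
    finally have "p \<cdot> g = Zero C a (Cod C p)" .
    moreover have "g \<in> Hom C a (Dom C p)"
      using g A psi assms(3) by (simp add: in_Hom)
    ultimately obtain u where "u \<in> Hom C a (Dom C i)" "i \<cdot> u = g"
      using kernel_factor[OF ip(1)] by blast
    then show "\<exists>u\<in>Hom C a (Dom C i). i \<cdot> u = g" by blast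
  qed (use A psi assms(3) zero kernel_monic[OF ip(1)] in simp_all)
  moreover have "is_cokernel C (\<psi> \<cdot> p) i"
  proof (rule is_cokernelI)
    show "epic C (\<psi> \<cdot> p)"
      using epic_Comp[OF cokernel_epic[OF ip(2)] isomorphism_epic[OF assms(2)] assms(3)] .
    fix b g assume g: "g \<in> Hom C (Cod C i) b" "g \<cdot> i = Zero C (Dom C i) b"
    obtain u where u: "u \<in> Hom C (Cod C p) b" "u \<cdot> p = g"
      using cokernel_factor[OF ip(2) g] .
    have "u \<cdot> \<chi> \<cdot> (\<psi> \<cdot> p) = u \<cdot> ((\<chi> \<cdot> \<psi>) \<cdot> p)"
      using u(1) chi(1) psi A assms(3) by (simp add: in_Hom)
    also have "\<dots> = g"
      using u chi(2) A assms(3) by (simp add: in_Hom)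
    finally show "\<exists>u\<in>Hom C (Cod C (\<psi> \<cdot> p)) b. u \<cdot> (\<psi> \<cdot> p) = g"
      using u(1) chi(1) A psi assms(3) by (intro bexI[of _ "u \<cdot> \<chi>"]) (auto simp: in_Hom)
  qed (use A psi assms(3) zero in simp_all)
  ultimately show ?thesis by (simp add: short_exact_def)
qed

end

section \<open>Pullbacks of epimorphisms and images\<close>

context abelian_category
begin

text \<open>By axiom \<open>h\<close> is the cokernel of some \<open>g\<close>. Since
  \<open>g\<close> factors through \<open>k\<close>, whatever kills \<open>k\<close> also kills
  \<open>g\<close> and so factors through \<open>h\<close>.\<close>

lemma epic_cokernel_of_kernel:
  assumes "epic C h" "is_kernel C k h"
  shows "is_cokernel C h k"
proof -
  obtain g where g: "is_cokernel C h g"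
    using epic_is_cokernel assms(1) by blast
  have A: "h \<in> Arr C" "k \<in> Arr C" "Cod C k = Dom C h" "h \<cdot> k = Zero C (Dom C k) (Cod C h)"
    "g \<in> Arr C" "Dom C h = Cod C g" "h \<cdot> g = Zero C (Dom C g) (Cod C h)"
    using assms(2) g by (auto simp: is_kernel_def is_cokernel_def)
  obtain u where u: "u \<in> Hom C (Dom C g) (Dom C k)" "k \<cdot> u = g"
    using kernel_factor[OF assms(2), of g "Dom C g"] A by (auto simp: in_Hom)
  show ?thesis
  proof (rule is_cokernelI)
    fix b r assume r: "r \<in> Hom C (Cod C k) b" "r \<cdot> k = Zero C (Dom C k) b"
    have "r \<cdot> g = (r \<cdot> k) \<cdot> u"
      using u r(1) A by (simp add: in_Hom)
    also have "\<dots> = Zero C (Dom C g) b"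
      unfolding r(2) using u(1) A Hom_Obj[OF r(1)] by (simp add: in_Hom)
    finally obtain w where "w \<in> Hom C (Cod C h) b" "w \<cdot> h = r"
      using cokernel_factor[OF g, of r b] r(1) A by auto
    then show "\<exists>u\<in>Hom C (Cod C h) b. u \<cdot> h = r" by blast
  qed (use A assms in simp_all)
qed

lemma epic_short_exact:
  assumes "epic C h"
  obtains k where "short_exact C k h"
  using assms kernel_ex[of h] epic_cokernel_of_kernel[OF assms]
  by (auto simp: short_exact_def epic_def)

text \<open>The pullback is the kernel \<open>k\<close> of \<open>f pr1 - g pr2\<close> on the
  product of \<open>a\<close> and \<open>b\<close>. The maps \<open>i\<close> and \<open>j\<close>
  are the biproduct injections; as \<open>h\<close> restricts to \<open>f\<close> along
  \<open>i\<close>, it is epic, hence the cokernel of \<open>k\<close>.\<close>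

lemma epic_pullback:
  assumes "epic C f" "f \<in> Hom C a c" "g \<in> Hom C b c"
  obtains Q q r where "q \<in> Hom C Q b" "epic C q" "r \<in> Hom C Q a" "f \<cdot> r = g \<cdot> q"
proof -
  have Obj: "a \<in> Obj C" "b \<in> Obj C" "c \<in> Obj C"
    using Hom_Obj assms by blast+
  obtain P pr where P: "is_product C (UNIV :: bool set) (\<lambda>t. if t then a else b) P pr"
    using binary_product_ex Obj by blast
  have pr: "P \<in> Obj C" "pr True \<in> Hom C P a" "pr False \<in> Hom C P b"
    using P unfolding is_product_def by (auto dest: spec[of _ True] spec[of _ False])
  obtain i where i: "i \<in> Hom C a P" "\<And>t. pr t \<cdot> i = (if t then Ident C a else Zero C a b)"
    by (rule product_map[OF P, of "\<lambda>t. if t then Ident C a else Zero C a b" a])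
      (use Obj in \<open>auto simp: in_Hom\<close>)
  obtain j where j: "j \<in> Hom C b P" "\<And>t. pr t \<cdot> j = (if t then Zero C b a else Ident C b)"
    by (rule product_map[OF P, of "\<lambda>t. if t then Zero C b a else Ident C b" b])
      (use Obj in \<open>auto simp: in_Hom\<close>)
  define h where "h = Diff C (f \<cdot> pr True) (g \<cdot> pr False)"
  have h: "h \<in> Hom C P c"
    using assms pr by (simp add: h_def in_Hom)
  have "h \<cdot> i = Diff C (f \<cdot> (pr True \<cdot> i)) (g \<cdot> (pr False \<cdot> i))"
    using Diff_Comp[of "f \<cdot> pr True" "g \<cdot> pr False" i] assms(2,3) pr i(1) by (simp add: h_def in_Hom)
  also have "\<dots> = f"
    using i(2) assms Obj Diff_eq_iff[of f "Zero C a c" f] by (simp add: in_Hom)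
  finally have hi: "h \<cdot> i = f" .
  then have "epic C h"
    using epic_cancel[of h i] assms(1) h i(1) by (simp add: in_Hom)
  then obtain k where k: "is_kernel C k h" "is_cokernel C h k"
    using epic_short_exact by (auto simp: short_exact_def)
  have kA: "k \<in> Arr C" "Cod C k = P" "h \<cdot> k = Zero C (Dom C k) c"
    using k h by (auto simp: is_kernel_def in_Hom)
  show thesis
  proof (rule that)
    show "pr False \<cdot> k \<in> Hom C (Dom C k) b" "pr True \<cdot> k \<in> Hom C (Dom C k) a"
      using kA pr by (auto simp: in_Hom)
    have "Diff C (f \<cdot> (pr True \<cdot> k)) (g \<cdot> (pr False \<cdot> k)) = Zero C (Dom C k) c"
      using kA assms(2,3) pr Diff_Comp[of "f \<cdot> pr True" "g \<cdot> pr False" k]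
      by (simp add: h_def in_Hom)
    then show "f \<cdot> (pr True \<cdot> k) = g \<cdot> (pr False \<cdot> k)"
      using Diff_eq_Zero_iff[of "f \<cdot> (pr True \<cdot> k)" "g \<cdot> (pr False \<cdot> k)"] kA assms(2,3) pr
      by (simp add: in_Hom)
    show "epic C (pr False \<cdot> k)"
    proof (rule epicI_zero)
      fix d r assume r: "r \<in> Hom C (Cod C (pr False \<cdot> k)) d"
        and rz: "r \<cdot> (pr False \<cdot> k) = Zero C (Dom C (pr False \<cdot> k)) d"
      have r': "r \<in> Hom C b d" "d \<in> Obj C"
        using r pr kA Hom_Obj by (auto simp: in_Hom)
      have "(r \<cdot> pr False) \<cdot> k = Zero C (Dom C k) d"
        using rz r' pr kA by (simp add: in_Hom)
      \<comment> \<open>Restricting \<open>s h = r pr2\<close> along \<open>i\<close> gives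
        \<open>s f = 0\<close>, so \<open>s = 0\<close> because \<open>f\<close> is epic;
        restricting along \<open>j\<close> then gives \<open>r = 0\<close>.\<close>
      then obtain s where s: "s \<in> Hom C c d" "s \<cdot> h = r \<cdot> pr False"
        using cokernel_factor[OF k(2), of "r \<cdot> pr False" d] r' pr kA h by (auto simp: in_Hom)
      have "s \<cdot> f = (s \<cdot> h) \<cdot> i"
        using hi s(1) h i(1) by (simp add: in_Hom)
      also have "\<dots> = Zero C a d"
        unfolding s(2) using i Obj r' pr by (simp add: in_Hom)
      finally have "s = Zero C c d"
        using epic_zeroD[OF assms(1), of s d] s(1) assms(2) by (simp add: in_Hom)
      then have "r \<cdot> pr False = Zero C P d"
        using s(2) h r' by (simp add: in_Hom)
      then have "(r \<cdot> pr False) \<cdot> j = Zero C b d"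
        using j(1) r' by (simp add: in_Hom)
      then show "r = Zero C (Cod C (pr False \<cdot> k)) d"
        using j r' pr kA by (simp add: in_Hom)
    qed (use kA pr in \<open>simp add: in_Hom\<close>)
  qed
qed

text \<open>The image is the kernel \<open>m\<close> of the cokernel of \<open>f\<close>. If
  \<open>r\<close> kills \<open>e\<close>, then \<open>f\<close> factors through the smaller
  subobject \<open>m k\<close> with \<open>k\<close> the kernel of \<open>r\<close>. As
  \<open>m k\<close> is itself a kernel, of \<open>g\<close> say, and \<open>g f = 0\<close>, also
  \<open>g m = 0\<close>, so \<open>m\<close> factors back through \<open>m k\<close>. Thus
  \<open>k\<close> has a right inverse and \<open>r = 0\<close>.\<close>

lemma image_factorization:
  assumes "f \<in> Hom C a b"
  obtains I e m c where "e \<in> Hom C a I" "epic C e" "m \<in> Hom C I b" "c \<in> Hom C b (Cod C c)"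
    "short_exact C m c" "m \<cdot> e = f"
proof -
  have f: "f \<in> Arr C" "Dom C f = a" "Cod C f = b"
    using assms by (auto simp: in_Hom)
  obtain c where c: "is_cokernel C c f" using cokernel_ex f by blast
  then have cA: "c \<in> Arr C" "Dom C c = b" "c \<cdot> f = Zero C a (Cod C c)"
    using f by (auto simp: is_cokernel_def)
  obtain m where m: "is_kernel C m c" using kernel_ex cA by blast
  then have mA: "m \<in> Arr C" "Cod C m = b" "c \<cdot> m = Zero C (Dom C m) (Cod C c)"
    using cA by (auto simp: is_kernel_def)
  obtain e where e: "e \<in> Hom C a (Dom C m)" "m \<cdot> e = f"
    using kernel_factor[OF m, of f a] f cA by (auto simp: in_Hom)
  have epi: "epic C e"
  proof (rule epicI_zero)
    fix d r assume r: "r \<in> Hom C (Cod C e) d" "r \<cdot> e = Zero C (Dom C e) d"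
    obtain k where k: "is_kernel C k r" using kernel_ex r by (auto simp: in_Hom)
    then have kA: "k \<in> Arr C" "Cod C k = Dom C m" "r \<cdot> k = Zero C (Dom C k) d"
      using r e by (auto simp: is_kernel_def in_Hom)
    obtain e' where e': "e' \<in> Hom C a (Dom C k)" "k \<cdot> e' = e"
      using kernel_factor[OF k, of e a] r e by (auto simp: in_Hom)
    have "monic C (m \<cdot> k)"
      using monic_Comp kernel_monic[OF k] kernel_monic[OF m] kA by simp
    then obtain g where g: "is_kernel C (m \<cdot> k) g" using monic_is_kernel by blast
    then have gA: "g \<in> Arr C" "Dom C g = b" "g \<cdot> (m \<cdot> k) = Zero C (Dom C k) (Cod C g)"
      using mA kA by (auto simp: is_kernel_def)
    have "g \<cdot> f = (g \<cdot> (m \<cdot> k)) \<cdot> e'"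
      using e e' mA kA gA(1,2) by (simp add: in_Hom)
    also have "\<dots> = Zero C a (Cod C g)"
      unfolding gA(3) using e' Cod_Obj gA kA by (simp add: in_Hom)
    finally obtain s where s: "s \<in> Hom C (Cod C c) (Cod C g)" "s \<cdot> c = g"
      using cokernel_factor[OF c, of g "Cod C g"] f gA by (auto simp: in_Hom)
    have "g \<cdot> m = s \<cdot> (c \<cdot> m)"
      using s cA(1,2) mA(1,2) by (auto simp: in_Hom)
    also have "\<dots> = Zero C (Dom C m) (Cod C g)"
      using s(1) mA Dom_Obj by (simp add: in_Hom)
    finally obtain t where t: "t \<in> Hom C (Dom C m) (Dom C k)" "(m \<cdot> k) \<cdot> t = m"
      using kernel_factor[OF g, of m "Dom C m"] gA mA kA by (auto simp: in_Hom)
    have "k \<cdot> t = Ident C (Dom C m)"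
      using monicD[OF kernel_monic[OF m], of "k \<cdot> t" "Dom C m" "Ident C (Dom C m)"]
        t mA kA Dom_Obj by (simp add: in_Hom)
    then have "r = (r \<cdot> k) \<cdot> t"
      using r e kA(1,2) t(1) by (simp add: in_Hom)
    then show "r = Zero C (Cod C e) d"
      unfolding kA(3) using t(1) e kA Hom_Obj[OF r(1)] by (simp add: in_Hom)
  qed (use e in \<open>simp add: in_Hom\<close>)
  have "is_cokernel C c m"
  proof (rule is_cokernelI)
    fix d g assume g: "g \<in> Hom C (Cod C m) d" "g \<cdot> m = Zero C (Dom C m) d"
    have "g \<cdot> f = (g \<cdot> m) \<cdot> e"
      using e g(1) mA by (auto simp: in_Hom)
    also have "\<dots> = Zero C a d"
      unfolding g(2) using e mA Hom_Obj[OF g(1)] by (simp add: in_Hom)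
    finally obtain u where "u \<in> Hom C (Cod C c) d" "u \<cdot> c = g"
      using cokernel_factor[OF c, of g d] g(1) f mA by (auto simp: in_Hom)
    then show "\<exists>u\<in>Hom C (Cod C c) d. u \<cdot> c = g" by blast
  qed (use cA mA cokernel_epic[OF c] in simp_all)
  then show thesis
    using that[of e "Dom C m" m c] e epi m cA mA by (auto simp: short_exact_def in_Hom)
qed

end

section \<open>Small families of epimorphisms\<close>

unbundle cardinal_syntax

text \<open>A cardinal order is equipotent to its field, so every small set embeds into the type
  \<open>'k\<close> over which the completeness hypotheses quantify.\<close>

lemma small_embedding:
  fixes \<kappa> :: "'k rel" and A :: "'a set"
  assumes "inaccessible \<kappa>" "small \<kappa> A"
  obtains e :: "'a \<Rightarrow> 'k" where "inj_on e A" "small \<kappa> (e ` A)"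
proof -
  have "|A| \<le>o |Field \<kappa>|"
    using assms card_of_Field_ordIso[of \<kappa>]
    by (meson inaccessible_def small_def ordIso_symmetric ordLess_imp_ordLeq ordLeq_ordIso_trans)
  then obtain e :: "'a \<Rightarrow> 'k" where "inj_on e A"
    by (auto simp: card_of_ordLeq[symmetric])
  then show thesis
    using that assms(2) card_of_image[of e A] by (auto simp: small_def intro: ordLeq_ordLess_trans)
qed

lemma bchoice2: "(\<And>x. x \<in> A \<Longrightarrow> \<exists>a b. R x a b) \<Longrightarrow> \<exists>f g. \<forall>x\<in>A. R x (f x) (g x)"
  by metis

lemma small_subset: "\<lbrakk>small \<kappa> A; B \<subseteq> A\<rbrakk> \<Longrightarrow> small \<kappa> B"
  unfolding small_def using card_of_mono1 ordLeq_ordLess_trans by blast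

text \<open>\<open>inaccessible\<close> bounds power sets of subsets of \<open>'k\<close> only, so
  the bound is pulled back along an embedding.\<close>

lemma small_Pow:
  fixes \<kappa> :: "'k rel" and A :: "'a set"
  assumes "inaccessible \<kappa>" "small \<kappa> A"
  shows "small \<kappa> (Pow A)"
proof -
  obtain e :: "'a \<Rightarrow> 'k" where e: "inj_on e A" "small \<kappa> (e ` A)"
    using small_embedding assms .
  have "|Pow A| \<le>o |Pow (e ` A)|"
    unfolding card_of_ordLeq[symmetric]
    using e(1) by (intro exI[of _ "image e"]) (auto intro: inj_on_image_Pow)
  moreover have "|Pow (e ` A)| <o \<kappa>"
    using assms(1) e(2) by (auto simp: inaccessible_def small_def)
  ultimately show ?thesis
    unfolding small_def by (rule ordLeq_ordLess_trans)
qed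

lemma small_nat: "inaccessible \<kappa> \<Longrightarrow> small \<kappa> (UNIV :: nat set)"
  unfolding inaccessible_def small_def using card_of_nat ordIso_ordLess_trans by blast

lemma small_empty: "inaccessible \<kappa> \<Longrightarrow> small \<kappa> {}"
  using small_nat[of \<kappa>] card_of_empty ordLeq_ordLess_trans unfolding small_def by blast

unbundle no cardinal_syntax

text \<open>AB4* is Grothendieck's name for the exactness of products. Fixing \<open>G\<close> and
  \<open>\<kappa>\<close> as parameters keeps one generator and one universe throughout.\<close>

locale ab4star_category = abelian_category C for C :: "('o, 'm) precat" (structure) +
  fixes \<kappa> :: "'k rel" and G :: 'o
  assumes inaccessible: "inaccessible \<kappa>"
    and locally_small: "locally_small \<kappa> C"
    and generator: "generator C G"
    and coproducts: "has_small_coproducts \<kappa> C"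
    and products: "has_small_products \<kappa> C"
    and products_exact: "small_products_exact \<kappa> C"
begin

lemma small_Hom: "small \<kappa> (Hom C a b)"
proof (cases "a \<in> Obj C \<and> b \<in> Obj C")
  case True
  then show ?thesis using locally_small by (simp add: locally_small_def)
next
  case False
  then have "Hom C a b = {}" using Hom_Obj by blast
  then show ?thesis using small_empty[OF inaccessible] by simp
qed

lemma G_Obj: "G \<in> Obj C"
  using generator by (simp add: generator_def)

lemma generator_eqI:
  assumes "f \<in> Hom C a b" "g \<in> Hom C a b" "\<And>x. x \<in> Hom C G a \<Longrightarrow> f \<cdot> x = g \<cdot> x"
  shows "f = g"
  using generator assms Hom_Obj[OF assms(1)] unfolding generator_def by blast

lemma product_ex:
  fixes A :: "'a set"
  assumes "small \<kappa> A" "\<And>j. j \<in> A \<Longrightarrow> X j \<in> Obj C"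
  obtains P pr where "is_product C A X P pr"
proof -
  obtain e :: "'a \<Rightarrow> 'k" where e: "inj_on e A" "small \<kappa> (e ` A)"
    using small_embedding[OF inaccessible assms(1)] .
  have "\<exists>P pr. is_product C (e ` A) (X \<circ> inv_into A e) P pr"
    using products assms(2) e by (auto simp: has_small_products_def)
  then obtain P pr where "is_product C (e ` A) (X \<circ> inv_into A e) P pr" by blast
  then have "is_product C A X P (pr \<circ> e)"
    by (rule is_product_reindex[OF inj_on_imp_bij_betw[OF e(1)]]) (use e in simp_all)
  then show thesis using that by blast
qed

lemma coproduct_ex:
  fixes A :: "'a set"
  assumes "small \<kappa> A" "\<And>j. j \<in> A \<Longrightarrow> X j \<in> Obj C"
  obtains P \<iota> where "is_coproduct C A X P \<iota>"
proof -
  obtain e :: "'a \<Rightarrow> 'k" where e: "inj_on e A" "small \<kappa> (e ` A)"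
    using small_embedding[OF inaccessible assms(1)] .
  have "\<exists>P \<iota>. is_coproduct C (e ` A) (X \<circ> inv_into A e) P \<iota>"
    using coproducts assms(2) e by (auto simp: has_small_coproducts_def)
  then obtain P \<iota> where "is_coproduct C (e ` A) (X \<circ> inv_into A e) P \<iota>" by blast
  then have "is_coproduct C A X P (\<iota> \<circ> e)"
    by (rule is_coproduct_reindex[OF inj_on_imp_bij_betw[OF e(1)]]) (use e in simp_all)
  then show thesis using that by blast
qed

lemma product_short_exact:
  fixes A :: "'a set"
  assumes "small \<kappa> A"
    and "\<And>j. j \<in> A \<Longrightarrow> i j \<in> Hom C (X j) (Y j) \<and> p j \<in> Hom C (Y j) (Z j) \<and> short_exact C (i j) (p j)"
    and "is_product C A X PX prX" "is_product C A Y PY prY" "is_product C A Z PZ prZ"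
    and "u \<in> Hom C PX PY" "\<And>j. j \<in> A \<Longrightarrow> prY j \<cdot> u = i j \<cdot> prX j"
    and "v \<in> Hom C PY PZ" "\<And>j. j \<in> A \<Longrightarrow> prZ j \<cdot> v = p j \<cdot> prY j"
  shows "short_exact C u v"
proof -
  obtain e :: "'a \<Rightarrow> 'k" where e: "inj_on e A" "small \<kappa> (e ` A)"
    using small_embedding[OF inaccessible assms(1)] .
  define g where "g = inv_into A e"
  have g: "bij_betw g (e ` A) A" "\<And>j. j \<in> A \<Longrightarrow> g (e j) = j"
    using bij_betw_inv_into[OF inj_on_imp_bij_betw[OF e(1)]] e(1) by (simp_all add: g_def)
  have prod: "is_product C (e ` A) (W \<circ> g) P (pr \<circ> g)" if "is_product C A W P pr" for W P pr
    by (rule is_product_reindex[OF g(1) that]) simp_all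
  show ?thesis
    using products_exact[unfolded small_products_exact_def, rule_format,
        of "e ` A" "i \<circ> g" "X \<circ> g" "Y \<circ> g" "p \<circ> g" "Z \<circ> g" PX "prX \<circ> g" PY "prY \<circ> g"
          PZ "prZ \<circ> g" u v]
      e(2) assms g(2) prod by auto
qed

text \<open>Each \<open>p j\<close> completes to a short exact sequence with its kernel; exactness
  of the product sequence makes \<open>v\<close> a cokernel.\<close>

lemma product_epic:
  fixes A :: "'a set"
  assumes "small \<kappa> A"
    and pA: "\<And>j. j \<in> A \<Longrightarrow> p j \<in> Hom C (Y j) (Z j) \<and> epic C (p j)"
    and PY: "is_product C A Y PY prY" and PZ: "is_product C A Z PZ prZ"
    and "v \<in> Hom C PY PZ" "\<And>j. j \<in> A \<Longrightarrow> prZ j \<cdot> v = p j \<cdot> prY j"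
  shows "epic C v"
proof -
  have "\<forall>j\<in>A. \<exists>k. short_exact C k (p j)"
    using pA epic_short_exact by metis
  then obtain k where k: "\<And>j. j \<in> A \<Longrightarrow> short_exact C (k j) (p j)" by metis
  define X where "X j = Dom C (k j)" for j
  have kA: "k j \<in> Hom C (X j) (Y j)" if "j \<in> A" for j
    using k[OF that] pA[OF that] by (auto simp: short_exact_def is_kernel_def X_def in_Hom)
  obtain PX prX where PX: "is_product C A X PX prX"
    using product_ex[OF assms(1), of X] kA Hom_Obj by blast
  have prX: "PX \<in> Obj C" "\<And>j. j \<in> A \<Longrightarrow> prX j \<in> Hom C PX (X j)"
    using PX by (auto simp: is_product_def)
  have q: "\<And>j. j \<in> A \<Longrightarrow> k j \<cdot> prX j \<in> Hom C PX (Y j)"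
    using kA prX Comp_Hom by blast
  obtain u where "u \<in> Hom C PX PY" "\<And>j. j \<in> A \<Longrightarrow> prY j \<cdot> u = k j \<cdot> prX j"
    using product_map[OF PY q prX(1)] by blast
  then have "short_exact C u v"
    using product_short_exact[OF assms(1) _ PX PY PZ, of k p u v] kA pA k assms(5,6) by blast
  then show ?thesis
    using cokernel_epic by (auto simp: short_exact_def)
qed

text \<open>The product of the \<open>q j\<close> is an epimorphism onto a power of
  \<open>X\<close>. Its pullback along the diagonal \<open>\<delta>\<close> is an epimorphism onto
  \<open>X\<close> that factors through every \<open>q j\<close>.\<close>

lemma common_refinement:
  fixes A :: "'a set"
  assumes "small \<kappa> A" "X \<in> Obj C"
    and q: "\<And>j. j \<in> A \<Longrightarrow> q j \<in> Hom C (Q j) X \<and> epic C (q j)"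
  shows "\<exists>R r. r \<in> Hom C R X \<and> epic C r \<and> (\<forall>j\<in>A. \<exists>s \<in> Hom C R (Q j). q j \<cdot> s = r)"
proof -
  obtain PQ prQ where PQ: "is_product C A Q PQ prQ"
    using product_ex[OF assms(1), of Q] q Hom_Obj by blast
  obtain PX prX where PX: "is_product C A (\<lambda>_. X) PX prX"
    using product_ex[OF assms(1), of "\<lambda>_. X"] assms(2) by blast
  have pr: "PQ \<in> Obj C" "\<And>j. j \<in> A \<Longrightarrow> prQ j \<in> Hom C PQ (Q j)"
    "\<And>j. j \<in> A \<Longrightarrow> prX j \<in> Hom C PX X"
    using PQ PX by (auto simp: is_product_def)
  have "\<And>j. j \<in> A \<Longrightarrow> q j \<cdot> prQ j \<in> Hom C PQ X"
    using pr q Comp_Hom by blast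
  then obtain v where v: "v \<in> Hom C PQ PX" "\<And>j. j \<in> A \<Longrightarrow> prX j \<cdot> v = q j \<cdot> prQ j"
    using product_map[OF PX _ pr(1), of "\<lambda>j. q j \<cdot> prQ j"] by blast
  have "epic C v"
    by (rule product_epic[OF assms(1) _ PQ PX v]) (use q in auto)
  obtain \<delta> where d: "\<delta> \<in> Hom C X PX" "\<And>j. j \<in> A \<Longrightarrow> prX j \<cdot> \<delta> = Ident C X"
    using product_map[OF PX _ assms(2), of "\<lambda>_. Ident C X"] Ident_Hom[OF assms(2)] by blast
  obtain R r s where R: "r \<in> Hom C R X" "epic C r" "s \<in> Hom C R PQ" "v \<cdot> s = \<delta> \<cdot> r"
    using epic_pullback[OF \<open>epic C v\<close> v(1) d(1)] .
  have "q j \<cdot> (prQ j \<cdot> s) = r" if j: "j \<in> A" for j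
  proof -
    have "q j \<cdot> (prQ j \<cdot> s) = (prX j \<cdot> v) \<cdot> s"
      using v(2)[OF j] R(3) pr(2)[OF j] q[OF j] by (simp add: in_Hom)
    also have "\<dots> = prX j \<cdot> (\<delta> \<cdot> r)"
      using v(1) pr(3)[OF j] R(3,4) by (simp add: in_Hom)
    also have "\<dots> = (prX j \<cdot> \<delta>) \<cdot> r"
      using d(1) pr(3)[OF j] R(1) by (simp add: in_Hom)
    also have "\<dots> = r"
      using d(2)[OF j] R(1) by (simp add: in_Hom)
    finally show ?thesis .
  qed
  moreover have "prQ j \<cdot> s \<in> Hom C R (Q j)" if "j \<in> A" for j
    using pr(2)[OF that] R(3) by (simp add: in_Hom)
  ultimately show ?thesis
    using R(1,2) by blast
qed

text \<open>An epimorphism onto \<open>G\<close> is refined by the canonical map from the sum of copies of \<open>G\<close>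
  indexed by the endomorphisms of \<open>G\<close> that factor through it. These maps form a small family,
  and a common refinement of them factors through every epimorphism onto \<open>G\<close>.\<close>

lemma universal_cover:
  obtains P p where "p \<in> Hom C P G" "epic C p"
    "\<And>Y e. \<lbrakk>e \<in> Hom C Y G; epic C e\<rbrakk> \<Longrightarrow> \<exists>s \<in> Hom C P Y. e \<cdot> s = p"
proof -
  define J where "J e = {r \<in> Hom C G G. \<exists>z \<in> Hom C G (Dom C e). e \<cdot> z = r}" for e
  \<comment> \<open>The epimorphisms onto \<open>G\<close> need not form a small family, but the
    sets \<open>J e\<close> are subsets of one small hom-set. One map \<open>c\<close> is to serve
    all \<open>e\<close> with \<open>J e = K\<close> simultaneously. If \<open>K\<close> is not of
    this form, only the typing of \<open>c\<close> remains, and \<open>c\<close> need not be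
    epic.\<close>
  define R where "R K Q c \<longleftrightarrow> c \<in> Hom C Q G \<and> (\<forall>Y e. e \<in> Hom C Y G \<and> epic C e \<and> J e = K \<longrightarrow>
      epic C c \<and> (\<exists>w \<in> Hom C Q Y. e \<cdot> w = c))" for K Q c
  have "\<exists>Q c. R K Q c" if K: "K \<in> Pow (Hom C G G)" for K
  proof -
    have "small \<kappa> K" using small_subset[OF small_Hom[of G G]] K by blast
    then obtain Q \<iota> where Q: "is_coproduct C K (\<lambda>_. G) Q \<iota>"
      using coproduct_ex[of K "\<lambda>_. G"] G_Obj by blast
    have \<iota>: "\<And>r. r \<in> K \<Longrightarrow> \<iota> r \<in> Hom C G Q"
      using Q by (auto simp: is_coproduct_def)
    obtain c where c: "c \<in> Hom C Q G" "\<And>r. r \<in> K \<Longrightarrow> c \<cdot> \<iota> r = r"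
      using coproduct_map[OF Q, of "\<lambda>r. r" G] K G_Obj by blast
    have "epic C c \<and> (\<exists>w \<in> Hom C Q Y. e \<cdot> w = c)"
      if e: "e \<in> Hom C Y G" "epic C e" "J e = K" for Y e
    proof
      have eY: "Dom C e = Y" using e by (simp add: in_Hom)
      show "epic C c"
        unfolding epic_def
      proof (intro conjI ballI impI)
        show "c \<in> Arr C" using c by (simp add: in_Hom)
        fix b g h assume "g \<in> Hom C (Cod C c) b" "h \<in> Hom C (Cod C c) b" and eq: "g \<cdot> c = h \<cdot> c"
        then have g: "g \<in> Hom C G b" and h: "h \<in> Hom C G b"
          using c by (auto simp: in_Hom)
        \<comment> \<open>Tested on maps \<open>z\<close> out of the generator: \<open>e z\<close>
          lies in \<open>K\<close>, so it is the restriction of \<open>c\<close> to one summand,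
          where \<open>g c = h c\<close> applies.\<close>
        have "g \<cdot> e = h \<cdot> e"
        proof (rule generator_eqI)
          fix z assume z: "z \<in> Hom C G Y"
          then have r: "e \<cdot> z \<in> K"
            using e Comp_Hom[OF z e(1)] by (auto simp: J_def eY[symmetric])
          have "g \<cdot> (e \<cdot> z) = (g \<cdot> c) \<cdot> \<iota> (e \<cdot> z)" "h \<cdot> (e \<cdot> z) = (h \<cdot> c) \<cdot> \<iota> (e \<cdot> z)"
            using c(1) c(2)[OF r] \<iota>[OF r] g h by (simp_all add: in_Hom)
          then have "g \<cdot> (e \<cdot> z) = h \<cdot> (e \<cdot> z)"
            using eq by simp
          then show "(g \<cdot> e) \<cdot> z = (h \<cdot> e) \<cdot> z"
            using e(1) g h z by (simp add: in_Hom)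
        qed (use e(1) g h Comp_Hom in blast)+
        then show "g = h"
          using epicD[OF e(2), of g b h] e(1) g h by (simp add: in_Hom)
      qed
      have "\<forall>r\<in>K. \<exists>z\<in>Hom C G Y. e \<cdot> z = r"
        using e(3) eY by (auto simp: J_def)
      \<comment> \<open>One lift through \<open>e\<close> is chosen for each index \<open>r\<close>;
        on the sum of copies of \<open>G\<close> these lifts assemble to \<open>w\<close>.\<close>
      then obtain z where z: "\<And>r. r \<in> K \<Longrightarrow> z r \<in> Hom C G Y \<and> e \<cdot> z r = r" by metis
      obtain w where w: "w \<in> Hom C Q Y" "\<And>r. r \<in> K \<Longrightarrow> w \<cdot> \<iota> r = z r"
        using coproduct_map[OF Q, of z Y] z Hom_Obj[OF e(1)] by blast
      have "e \<cdot> w = c"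
      proof (rule coproduct_eqI[OF Q])
        fix r assume r: "r \<in> K"
        show "(e \<cdot> w) \<cdot> \<iota> r = c \<cdot> \<iota> r"
          using w(1) w(2)[OF r] z[OF r] \<iota>[OF r] c(2)[OF r] e(1) by (simp add: in_Hom)
      qed (use e w c Comp_Hom in blast)+
      then show "\<exists>w \<in> Hom C Q Y. e \<cdot> w = c" using w by blast
    qed
    then show ?thesis using c(1) unfolding R_def by blast
  qed
  then obtain Q c where "\<And>K. K \<in> Pow (Hom C G G) \<Longrightarrow> R K (Q K) (c K)"
    using bchoice2[of "Pow (Hom C G G)" R] by blast
  then have c: "\<And>K. K \<in> Pow (Hom C G G) \<Longrightarrow> c K \<in> Hom C (Q K) G"
    "\<And>K Y e. \<lbrakk>K \<in> Pow (Hom C G G); e \<in> Hom C Y G; epic C e; J e = K\<rbrakk>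
      \<Longrightarrow> epic C (c K) \<and> (\<exists>w \<in> Hom C (Q K) Y. e \<cdot> w = c K)"
    unfolding R_def by blast+
  \<comment> \<open>The filter drops those \<open>K\<close> that come from no epimorphism and whose
    \<open>c K\<close> fails to be epic.\<close>
  let ?A = "{K \<in> Pow (Hom C G G). epic C (c K)}"
  have sm: "small \<kappa> ?A"
    by (rule small_subset[OF small_Pow[OF inaccessible small_Hom[of G G]]]) blast
  have ref: "\<And>K. K \<in> ?A \<Longrightarrow> c K \<in> Hom C (Q K) G \<and> epic C (c K)"
    using c(1) by blast
  from common_refinement[OF sm G_Obj, of c Q, OF ref]
  obtain P p where p: "p \<in> Hom C P G" "epic C p"
    "\<forall>K\<in>?A. \<exists>s \<in> Hom C P (Q K). c K \<cdot> s = p"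
    by blast
  have "\<exists>s \<in> Hom C P Y. e \<cdot> s = p" if e: "e \<in> Hom C Y G" "epic C e" for Y e
  proof -
    have K: "J e \<in> Pow (Hom C G G)" by (auto simp: J_def)
    obtain w where w: "epic C (c (J e))" "w \<in> Hom C (Q (J e)) Y" "e \<cdot> w = c (J e)"
      using c(2)[OF K e] by blast
    obtain s where s: "s \<in> Hom C P (Q (J e))" "c (J e) \<cdot> s = p"
      using p(3) K w(1) by blast
    have "e \<cdot> (w \<cdot> s) = p"
      using Comp_assoc[OF s(1) w(2) e(1)] w(3) s(2) by simp
    then show ?thesis using Comp_Hom[OF s(1) w(2)] by blast
  qed
  then show thesis using that p by blast
qed

text \<open>Equality of \<open>g\<close> and \<open>h\<close> can be tested on maps out of
  \<open>G\<close>, and the cover \<open>p\<close> can be cancelled afterwards. So a lift of each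
  such map over its own cover suffices.\<close>

lemma epicI_generator:
  assumes f: "f \<in> Hom C a b"
    and lift: "\<And>x. x \<in> Hom C G b \<Longrightarrow>
      \<exists>P p y. p \<in> Hom C P G \<and> epic C p \<and> y \<in> Hom C P a \<and> f \<cdot> y = x \<cdot> p"
  shows "epic C f"
  unfolding epic_def
proof (intro conjI ballI impI)
  show "f \<in> Arr C" using f by (simp add: in_Hom)
  fix d g h assume "g \<in> Hom C (Cod C f) d" "h \<in> Hom C (Cod C f) d" and eq: "g \<cdot> f = h \<cdot> f"
  then have g: "g \<in> Hom C b d" and h: "h \<in> Hom C b d" using f by (auto simp: in_Hom)
  show "g = h"
  proof (rule generator_eqI[OF g h])
    fix x assume x: "x \<in> Hom C G b"
    obtain P p y where p: "p \<in> Hom C P G" "epic C p" "y \<in> Hom C P a" "f \<cdot> y = x \<cdot> p"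
      using lift[OF x] by blast
    have "(g \<cdot> x) \<cdot> p = (g \<cdot> f) \<cdot> y"
      using p g x f by (simp add: in_Hom)
    also have "\<dots> = (h \<cdot> x) \<cdot> p"
      unfolding eq using p h x f by (simp add: in_Hom)
    finally show "g \<cdot> x = h \<cdot> x"
      using epicD[OF p(2), of "g \<cdot> x" d "h \<cdot> x"] p(1) g h x by (simp add: in_Hom)
  qed
qed

text \<open>For a universal cover \<open>p\<close> of \<open>G\<close>, call \<open>y : P \<rightarrow> E\<^sub>k\<close> dead if every attempt to continue
  \<open>y\<close> to an infinite thread stops after finitely many steps. By well-founded induction, using
  products of epimorphisms to treat all continuations of \<open>y\<close> at once, a pair \<open>(x, t)\<close> can be covered
  in such a way that it does not pull back to \<open>(y, p)\<close> for any dead \<open>y\<close>. For \<open>t = 1\<close> this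
  contradicts the universality of \<open>p\<close>, so \<open>x \<cdot> p\<close> is not dead.\<close>

lemma thread_lifting:
  assumes S: "inverse_sequence C E" and epi: "epimorphic C E"
    and a: "\<And>n. a n \<in> Hom C G (ob E n)" and x: "x \<in> Hom C G (ob E 0)"
  obtains P p y where "p \<in> Hom C P G" "epic C p" "\<And>n. y n \<in> Hom C P (ob E n)" "y 0 = x \<cdot> p"
    "\<And>n. y n = Add C (bond E n \<cdot> y (Suc n)) (a n \<cdot> p)"
proof -
  obtain P p where p: "p \<in> Hom C P G" "epic C p"
    "\<And>Y e. \<lbrakk>e \<in> Hom C Y G; epic C e\<rbrakk> \<Longrightarrow> \<exists>s \<in> Hom C P Y. e \<cdot> s = p"
    using universal_cover by metis
  have f: "bond E n \<in> Hom C (ob E (Suc n)) (ob E n)" "epic C (bond E n)" for n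
    using S epi by (auto simp: inverse_sequence_def epimorphic_def)
  \<comment> \<open>Continuations lie below what they continue, so \<open>acc r\<close> consists of
    the dead pairs. The level \<open>k\<close> is part of the pair because an arrow does not
    determine its level.\<close>
  define r where "r = {((Suc k, y'), (k, y)) |k y y'. y' \<in> Hom C P (ob E (Suc k)) \<and>
      y = Add C (bond E k \<cdot> y') (a k \<cdot> p)}"
  \<comment> \<open>The arrow \<open>t\<close> records how \<open>X\<close> lies over
    \<open>G\<close>. It has to be general, since the induction replaces \<open>X\<close> by covers
    \<open>X'\<close> and \<open>t\<close> by its restriction to them.\<close>
  have dead: "\<exists>Q q. q \<in> Hom C Q X \<and> epic C q \<and>
      (\<forall>s \<in> Hom C P Q. \<not> (z \<cdot> q \<cdot> s = snd ky \<and> t \<cdot> q \<cdot> s = p))"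
    if "ky \<in> Wellfounded.acc r" "z \<in> Hom C X (ob E (fst ky))" "t \<in> Hom C X G" for ky z t X
    using that
  proof (induction ky arbitrary: X z t rule: acc.induct)
    case (accI ky)
    obtain k y where ky: "ky = (k, y)" by (cases ky)
    have z: "z \<in> Hom C X (ob E k)" and t: "t \<in> Hom C X G"
      using accI.prems ky by auto
    \<comment> \<open>A continuation of \<open>z\<close> over \<open>X\<close> would be a lift of
      \<open>z - a k t\<close> along the bond; such a lift \<open>z'\<close> exists over the cover
      \<open>q\<close>.\<close>
    define g where "g = Diff C z (a k \<cdot> t)"
    have g: "g \<in> Hom C X (ob E k)"
      using z t a[of k] by (simp add: g_def in_Hom)
    obtain X' q z' where q: "q \<in> Hom C X' X" "epic C q" "z' \<in> Hom C X' (ob E (Suc k))"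
      "bond E k \<cdot> z' = g \<cdot> q"
      using epic_pullback[OF f(2) f(1) g] .
    have zq: "z \<cdot> q = Add C (bond E k \<cdot> z') (a k \<cdot> (t \<cdot> q))"
    proof -
      have "z = Add C g (a k \<cdot> t)"
        using Diff_eq_iff[of z "a k \<cdot> t" g] g_def z t a[of k] by (simp add: in_Hom)
      then have "z \<cdot> q = Add C (g \<cdot> q) ((a k \<cdot> t) \<cdot> q)"
        using Add_Comp_Arr[of g "a k \<cdot> t" q] g t a[of k] q(1) by (simp add: in_Hom)
      then show ?thesis
        using q t a[of k] by (simp add: in_Hom)
    qed
    \<comment> \<open>All continuations of \<open>y\<close> over \<open>P\<close>. They form a
      subset of a hom-set, hence a small set, so the covers from the induction hypothesis have a
      common refinement \<open>w\<close>.\<close>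
    let ?A = "{y' \<in> Hom C P (ob E (Suc k)). y = Add C (bond E k \<cdot> y') (a k \<cdot> p)}"
    have tq: "t \<cdot> q \<in> Hom C X' G" using t q Comp_Hom by blast
    define R where "R y' Q u \<longleftrightarrow> u \<in> Hom C Q X' \<and> epic C u \<and>
      (\<forall>s \<in> Hom C P Q. \<not> (z' \<cdot> u \<cdot> s = y' \<and> t \<cdot> q \<cdot> u \<cdot> s = p))" for y' Q u
    have "\<exists>Q u. R y' Q u" if "y' \<in> ?A" for y'
    proof -
      have "((Suc k, y'), ky) \<in> r" using that by (auto simp: r_def ky)
      then show ?thesis
        unfolding R_def using accI.IH[of "(Suc k, y')" z' X' "t \<cdot> q"] q(3) tq by simp
    qed
    then obtain Q u where "\<And>y'. y' \<in> ?A \<Longrightarrow> R y' (Q y') (u y')"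
      using bchoice2[of ?A R] by blast
    then have u: "\<And>y'. y' \<in> ?A \<Longrightarrow> u y' \<in> Hom C (Q y') X' \<and> epic C (u y')"
      and no: "\<And>y' s. \<lbrakk>y' \<in> ?A; s \<in> Hom C P (Q y')\<rbrakk>
        \<Longrightarrow> \<not> (z' \<cdot> u y' \<cdot> s = y' \<and> t \<cdot> q \<cdot> u y' \<cdot> s = p)"
      unfolding R_def by blast+
    have sm: "small \<kappa> ?A"
      by (rule small_subset[OF small_Hom[of P "ob E (Suc k)"]]) blast
    have "X' \<in> Obj C" using Hom_Obj[OF q(1)] by blast
    from common_refinement[OF sm this, of u Q, OF u] obtain W w where w: "w \<in> Hom C W X'" "epic C w"
      "\<forall>y'\<in>?A. \<exists>s \<in> Hom C W (Q y'). u y' \<cdot> s = w"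
      by blast
    \<comment> \<open>If \<open>s\<close> pulled \<open>(z, t)\<close> back to
      \<open>(y, p)\<close>, then \<open>z' w s\<close> would be a continuation \<open>y'\<close> of
      \<open>y\<close>. But \<open>w\<close> factors through the cover \<open>u y'\<close>, which
      was chosen to exclude exactly this pair.\<close>
    have "\<not> (z \<cdot> (q \<cdot> w) \<cdot> s = y \<and> t \<cdot> (q \<cdot> w) \<cdot> s = p)" if s: "s \<in> Hom C P W" for s
    proof
      assume eq: "z \<cdot> (q \<cdot> w) \<cdot> s = y \<and> t \<cdot> (q \<cdot> w) \<cdot> s = p"
      define y' where "y' = z' \<cdot> (w \<cdot> s)"
      have y': "y' \<in> Hom C P (ob E (Suc k))"
        using q(3) w(1) s by (simp add: y'_def in_Hom)
      have "y = (z \<cdot> q) \<cdot> (w \<cdot> s)"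
        using eq z q(1) w(1) s by (simp add: in_Hom)
      also have "\<dots> = Add C (bond E k \<cdot> y') (a k \<cdot> (t \<cdot> q \<cdot> (w \<cdot> s)))"
        unfolding zq y'_def
        using Add_Comp_Arr[of "bond E k \<cdot> z'" "a k \<cdot> (t \<cdot> q)" "w \<cdot> s"]
          q(1,3) w(1) s f(1)[of k] a[of k] t by (simp add: in_Hom)
      also have "t \<cdot> q \<cdot> (w \<cdot> s) = p"
        using eq t q(1) w(1) s by (simp add: in_Hom)
      finally have A: "y' \<in> ?A" using y' by blast
      obtain s' where s': "s' \<in> Hom C W (Q y')" "u y' \<cdot> s' = w"
        using w(3) A by blast
      have "u y' \<cdot> (s' \<cdot> s) = w \<cdot> s"
        using s' s u[OF A] by (auto simp: in_Hom)
      then have "z' \<cdot> u y' \<cdot> (s' \<cdot> s) = y'" "t \<cdot> q \<cdot> u y' \<cdot> (s' \<cdot> s) = p"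
        using eq q(1,3) t w(1) s s'(1) u[OF A] by (simp_all add: in_Hom y'_def)
      then show False
        using no[OF A Comp_Hom[OF s s'(1)]] by blast
    qed
    moreover have "epic C (q \<cdot> w)" "q \<cdot> w \<in> Hom C W X"
      using epic_Comp[OF w(2) q(2)] q(1) w(1) by (simp_all add: in_Hom)
    ultimately show ?case
      unfolding ky by (intro exI[of _ W] exI[of _ "q \<cdot> w"]) simp
  qed
  have alive: "(0, x \<cdot> p) \<notin> Wellfounded.acc r"
  proof
    assume "(0, x \<cdot> p) \<in> Wellfounded.acc r"
    then obtain Q q where q: "q \<in> Hom C Q G" "epic C q"
      "\<And>s. s \<in> Hom C P Q \<Longrightarrow> \<not> (x \<cdot> q \<cdot> s = x \<cdot> p \<and> Ident C G \<cdot> q \<cdot> s = p)"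
      using dead[of "(0, x \<cdot> p)" x G "Ident C G"] x Ident_Hom[OF G_Obj] by auto
    obtain s where "s \<in> Hom C P Q" "q \<cdot> s = p" using p(3)[OF q(1,2)] by blast
    then show False
      using q(3)[of s] q(1) x by (simp add: in_Hom)
  qed
  have step: "\<exists>y'. (y' \<in> Hom C P (ob E (Suc n)) \<and> (Suc n, y') \<notin> Wellfounded.acc r) \<and>
      y = Add C (bond E n \<cdot> y') (a n \<cdot> p)"
    if alive: "(n, y) \<notin> Wellfounded.acc r" for y n
  proof -
    obtain m where "(m, (n, y)) \<in> r" "m \<notin> Wellfounded.acc r"
      using alive acc.accI[of "(n, y)" r] by blast
    then show ?thesis by (auto simp: r_def)
  qed
  \<comment> \<open>Dependent choice does not prescribe the initial value, so the clause for
    \<open>n = 0\<close> pins it to \<open>x \<cdot> p\<close>.\<close>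
  define Q where "Q n y \<longleftrightarrow> y \<in> Hom C P (ob E n) \<and> (n, y) \<notin> Wellfounded.acc r \<and> (n = 0 \<longrightarrow> y = x \<cdot> p)"
    for n y
  have "\<exists>y. \<forall>n. Q n (y n) \<and> y n = Add C (bond E n \<cdot> y (Suc n)) (a n \<cdot> p)"
  proof (rule dependent_nat_choice)
    show "\<exists>y. Q 0 y" using alive Comp_Hom[OF p(1) x] by (auto simp: Q_def)
    show "\<exists>y'. Q (Suc n) y' \<and> y = Add C (bond E n \<cdot> y') (a n \<cdot> p)" if "Q n y" for y n
      using step[of n y] that by (auto simp: Q_def)
  qed
  then obtain y where "\<forall>n. Q n (y n) \<and> y n = Add C (bond E n \<cdot> y (Suc n)) (a n \<cdot> p)" by blast
  then show thesis using that[OF p(1,2), of y] unfolding Q_def by blast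
qed

end

section \<open>Inverse sequences\<close>

text \<open>A cone over \<open>S\<close> with vertex \<open>X\<close>, that is, a generalized
  element of the limit. Arguing with cones avoids fixing a limit object.\<close>

definition thread :: "('o, 'm) precat \<Rightarrow> ('o, 'm) invseq \<Rightarrow> 'o \<Rightarrow> (nat \<Rightarrow> 'm) \<Rightarrow> bool" where
  "thread C S X t \<longleftrightarrow> (\<forall>n. t n \<in> Hom C X (ob S n) \<and> bond S n \<cdot>\<^bsub>C\<^esub> t (Suc n) = t n)"

text \<open>The arrow condition of \<open>invseq_cat\<close> as a relation, so that proofs can work
  with components instead of triples.\<close>

definition invseq_mor ::
  "('o, 'm) precat \<Rightarrow> ('o, 'm) invseq \<Rightarrow> (nat \<Rightarrow> 'm) \<Rightarrow> ('o, 'm) invseq \<Rightarrow> bool" where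
  "invseq_mor C S \<phi> T \<longleftrightarrow> inverse_sequence C S \<and> inverse_sequence C T \<and>
    (\<forall>n. \<phi> n \<in> Hom C (ob S n) (ob T n) \<and> \<phi> n \<cdot>\<^bsub>C\<^esub> bond S n = bond T n \<cdot>\<^bsub>C\<^esub> \<phi> (Suc n))"

lemma invseq_cat_simps [simp]:
  "Obj (invseq_cat C) = {S. inverse_sequence C S}"
  "(S, \<phi>, T) \<in> Arr (invseq_cat C) \<longleftrightarrow> invseq_mor C S \<phi> T"
  "Dom (invseq_cat C) (S, \<phi>, T) = S"
  "Cod (invseq_cat C) (S, \<phi>, T) = T"
  "Ident (invseq_cat C) S = (S, \<lambda>n. Ident C (ob S n), S)"
  "Comp (invseq_cat C) (T', \<psi>, U) (S, \<phi>, T) = (S, \<lambda>n. \<psi> n \<cdot>\<^bsub>C\<^esub> \<phi> n, U)"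
  "Zero (invseq_cat C) S T = (S, \<lambda>n. Zero C (ob S n) (ob T n), T)"
  by (auto simp: invseq_cat_def invseq_mor_def)

lemma Hom_invseq_cat:
  "f \<in> Hom (invseq_cat C) S T \<longleftrightarrow> (\<exists>\<phi>. f = (S, \<phi>, T) \<and> invseq_mor C S \<phi> T)"
  by (cases f) (auto simp: Hom_def)

lemma Hom_invseq_cat_iff [simp]:
  "(S', \<phi>, T') \<in> Hom (invseq_cat C) S T \<longleftrightarrow> S' = S \<and> T' = T \<and> invseq_mor C S \<phi> T"
  by (auto simp: Hom_def)

section \<open>The category of inverse sequences\<close>

context category
begin

lemma inverse_sequenceD:
  assumes "inverse_sequence C S"
  shows "ob S n \<in> Obj C" "bond S n \<in> Arr C" "Dom C (bond S n) = ob S (Suc n)"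
    "Cod C (bond S n) = ob S n"
  using assms by (auto simp: inverse_sequence_def in_Hom)

lemma invseq_morD:
  assumes "invseq_mor C S \<phi> T"
  shows "\<phi> n \<in> Arr C" "Dom C (\<phi> n) = ob S n" "Cod C (\<phi> n) = ob T n"
    "\<phi> n \<cdot> bond S n = bond T n \<cdot> \<phi> (Suc n)"
  using assms by (auto simp: invseq_mor_def in_Hom)

lemma threadD:
  assumes "thread C S X t"
  shows "t n \<in> Arr C" "Dom C (t n) = X" "Cod C (t n) = ob S n" "bond S n \<cdot> t (Suc n) = t n"
  using assms by (auto simp: thread_def in_Hom)

lemma thread_Obj: "thread C S X t \<Longrightarrow> X \<in> Obj C"
  using Hom_Obj by (auto simp: thread_def)

lemma invseq_mor_Comp:
  assumes "invseq_mor C S \<phi> T" "invseq_mor C T \<psi> U"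
  shows "invseq_mor C S (\<lambda>n. \<psi> n \<cdot> \<phi> n) U"
proof -
  note D = invseq_morD[OF assms(1)] invseq_morD[OF assms(2)]
  have S: "inverse_sequence C S" "inverse_sequence C T" "inverse_sequence C U"
    using assms by (auto simp: invseq_mor_def)
  note B = inverse_sequenceD[OF S(1)] inverse_sequenceD[OF S(2)] inverse_sequenceD[OF S(3)]
  have "(\<psi> n \<cdot> \<phi> n) \<cdot> bond S n = bond U n \<cdot> (\<psi> (Suc n) \<cdot> \<phi> (Suc n))" for n
  proof -
    have "(\<psi> n \<cdot> \<phi> n) \<cdot> bond S n = \<psi> n \<cdot> (\<phi> n \<cdot> bond S n)"
      using D(1-3,5-7) B by simp
    also have "\<dots> = (\<psi> n \<cdot> bond T n) \<cdot> \<phi> (Suc n)"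
      unfolding D(4) using D(1-3,5-7) B by simp
    also have "\<dots> = bond U n \<cdot> (\<psi> (Suc n) \<cdot> \<phi> (Suc n))"
      unfolding D(8) using D(1-3,5-7) B by simp
    finally show ?thesis .
  qed
  then show ?thesis
    using D S by (simp add: invseq_mor_def in_Hom)
qed

lemma invseq_category: "category (invseq_cat C)"
proof
  let ?D = "invseq_cat C"
  show "Dom ?D f \<in> Obj ?D" "Cod ?D f \<in> Obj ?D" if "f \<in> Arr ?D" for f
    using that by (cases f; auto simp: invseq_mor_def)+
  show "Ident ?D S \<in> Hom ?D S S" if "S \<in> Obj ?D" for S
    using that inverse_sequenceD[of S] by (auto simp: invseq_mor_def in_Hom)
  show "Comp ?D g f \<in> Hom ?D S U" if "f \<in> Hom ?D S T" "g \<in> Hom ?D T U" for f g S T U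
    using that invseq_mor_Comp by (auto simp: Hom_invseq_cat)
  show "Comp ?D f (Ident ?D S) = f" "Comp ?D (Ident ?D T) f = f" if "f \<in> Hom ?D S T" for f S T
    using that by (auto simp: Hom_invseq_cat invseq_morD)
  show "Comp ?D (Comp ?D h g) f = Comp ?D h (Comp ?D g f)"
    if "f \<in> Hom ?D S T" "g \<in> Hom ?D T U" "h \<in> Hom ?D U V" for f g h S T U V
    using that by (auto simp: Hom_invseq_cat invseq_morD)
qed

lemma invseq_isomorphism_components:
  assumes "isomorphism (invseq_cat C) (S, \<phi>, T)"
  shows "isomorphism C (\<phi> n)"
proof -
  obtain \<psi> where "invseq_mor C S \<phi> T" "invseq_mor C T \<psi> S"
    "\<And>n. \<psi> n \<cdot> \<phi> n = Ident C (ob S n)" "\<And>n. \<phi> n \<cdot> \<psi> n = Ident C (ob T n)"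
    using assms by (auto simp: isomorphism_def Hom_invseq_cat fun_eq_iff)
  then show ?thesis
    unfolding isomorphism_def using invseq_morD
    by (intro conjI bexI[of _ "\<psi> n"]) (auto simp: in_Hom)
qed

end

context preadditive_category
begin

text \<open>Universal factorizations exist in each component. They commute with the bonds because
  this can be checked after the monic \<open>\<iota> n\<close>, respectively before the epic
  \<open>\<pi> (Suc n)\<close>.\<close>

lemma invseq_short_exactI:
  assumes i: "invseq_mor C E \<iota> S" and p: "invseq_mor C S \<pi> T"
    and ex: "\<And>n. short_exact C (\<iota> n) (\<pi> n)"
  shows "short_exact (invseq_cat C) (E, \<iota>, S) (S, \<pi>, T)"
proof -
  let ?D = "invseq_cat C"
  note I = invseq_morD[OF i] and P = invseq_morD[OF p]
  have invs: "inverse_sequence C E" "inverse_sequence C S" "inverse_sequence C T"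
    using i p by (auto simp: invseq_mor_def)
  note BE = inverse_sequenceD[OF invs(1)] and BS = inverse_sequenceD[OF invs(2)]
    and BT = inverse_sequenceD[OF invs(3)]
  have ker: "is_kernel C (\<iota> n) (\<pi> n)" and coker: "is_cokernel C (\<pi> n) (\<iota> n)" for n
    using ex[of n] by (auto simp: short_exact_def)
  have z: "\<pi> n \<cdot> \<iota> n = Zero C (ob E n) (ob T n)" for n
    using ker[of n] I(2)[of n] P(3)[of n] by (simp add: is_kernel_def)
  interpret D: category ?D by (rule invseq_category)
  have "monic ?D (E, \<iota>, S)"
    unfolding monic_def
  proof (intro conjI ballI impI)
    fix A g h
    assume "g \<in> Hom ?D A (Dom ?D (E, \<iota>, S))" "h \<in> Hom ?D A (Dom ?D (E, \<iota>, S))"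
      and "Comp ?D (E, \<iota>, S) g = Comp ?D (E, \<iota>, S) h"
    then obtain \<gamma> \<eta> where g: "g = (A, \<gamma>, E)" "invseq_mor C A \<gamma> E"
      and h: "h = (A, \<eta>, E)" "invseq_mor C A \<eta> E"
      and "(\<lambda>n. \<iota> n \<cdot> \<gamma> n) = (\<lambda>n. \<iota> n \<cdot> \<eta> n)"
      by (auto simp: Hom_invseq_cat)
    then have eq: "\<And>n. \<iota> n \<cdot> \<gamma> n = \<iota> n \<cdot> \<eta> n" by meson
    have "\<gamma> n = \<eta> n" for n
      using monicD[OF kernel_monic[OF ker[of n]], of "\<gamma> n" "ob A n" "\<eta> n"] eq[of n] I
        invseq_morD[OF g(2)] invseq_morD[OF h(2)] by (simp add: in_Hom)
    then show "g = h" using g h by auto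
  qed (use i in simp)
  moreover have "epic ?D (S, \<pi>, T)"
    unfolding epic_def
  proof (intro conjI ballI impI)
    fix A g h
    assume "g \<in> Hom ?D (Cod ?D (S, \<pi>, T)) A" "h \<in> Hom ?D (Cod ?D (S, \<pi>, T)) A"
      and "Comp ?D g (S, \<pi>, T) = Comp ?D h (S, \<pi>, T)"
    then obtain \<gamma> \<eta> where g: "g = (T, \<gamma>, A)" "invseq_mor C T \<gamma> A"
      and h: "h = (T, \<eta>, A)" "invseq_mor C T \<eta> A"
      and "(\<lambda>n. \<gamma> n \<cdot> \<pi> n) = (\<lambda>n. \<eta> n \<cdot> \<pi> n)"
      by (auto simp: Hom_invseq_cat)
    then have eq: "\<And>n. \<gamma> n \<cdot> \<pi> n = \<eta> n \<cdot> \<pi> n" by meson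
    have "\<gamma> n = \<eta> n" for n
      using epicD[OF cokernel_epic[OF coker[of n]], of "\<gamma> n" "ob A n" "\<eta> n"] eq[of n] P
        invseq_morD[OF g(2)] invseq_morD[OF h(2)] by (simp add: in_Hom)
    then show "g = h" using g h by auto
  qed (use p in simp)
  moreover have "\<exists>u \<in> Hom ?D A E. Comp ?D (E, \<iota>, S) u = g"
    if g: "g \<in> Hom ?D A S" and gz: "Comp ?D (S, \<pi>, T) g = Zero ?D A T" for A g
  proof -
    obtain \<gamma> where \<gamma>: "g = (A, \<gamma>, S)" "invseq_mor C A \<gamma> S"
      using g by (auto simp: Hom_invseq_cat)
    then have "\<And>n. \<pi> n \<cdot> \<gamma> n = Zero C (ob A n) (ob T n)"
      using gz by (auto simp: fun_eq_iff)
    then have "\<forall>n. \<exists>u. u \<in> Hom C (ob A n) (ob E n) \<and> \<iota> n \<cdot> u = \<gamma> n"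
      using kernel_factor[OF ker] invseq_morD[OF \<gamma>(2)] I P by (metis in_Hom)
    then obtain u where u: "\<And>n. u n \<in> Hom C (ob A n) (ob E n)" "\<And>n. \<iota> n \<cdot> u n = \<gamma> n" by metis
    have uA: "u n \<in> Arr C" "Dom C (u n) = ob A n" "Cod C (u n) = ob E n" for n
      using u(1)[of n] by (auto simp: in_Hom)
    have A: "inverse_sequence C A" using \<gamma> by (simp add: invseq_mor_def)
    note BA = inverse_sequenceD[OF A]
    have "u n \<cdot> bond A n = bond E n \<cdot> u (Suc n)" for n
    proof -
      have "\<iota> n \<cdot> (u n \<cdot> bond A n) = (\<iota> n \<cdot> u n) \<cdot> bond A n"
        using uA I(1-3) BA by simp
      also have "\<dots> = bond S n \<cdot> (\<iota> (Suc n) \<cdot> u (Suc n))"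
        unfolding u(2) using invseq_morD[OF \<gamma>(2)] by simp
      also have "\<dots> = (bond S n \<cdot> \<iota> (Suc n)) \<cdot> u (Suc n)"
        using uA I(1-3) BS by simp
      also have "\<dots> = \<iota> n \<cdot> (bond E n \<cdot> u (Suc n))"
        unfolding I(4)[symmetric] using uA I(1-3) BE by simp
      finally show ?thesis
        using monicD[OF kernel_monic[OF ker[of n]], of "u n \<cdot> bond A n" "ob A (Suc n)"
          "bond E n \<cdot> u (Suc n)"]
          uA BA BE I(2) by (simp add: in_Hom)
    qed
    then have "invseq_mor C A u E"
      using u A invs by (simp add: invseq_mor_def)
    then show ?thesis
      using u \<gamma> by (intro bexI[of _ "(A, u, E)"]) simp_all
  qed
  moreover have "\<exists>u \<in> Hom ?D T A. Comp ?D u (S, \<pi>, T) = g"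
    if g: "g \<in> Hom ?D S A" and gz: "Comp ?D g (E, \<iota>, S) = Zero ?D E A" for A g
  proof -
    obtain \<gamma> where \<gamma>: "g = (S, \<gamma>, A)" "invseq_mor C S \<gamma> A"
      using g by (auto simp: Hom_invseq_cat)
    then have "\<And>n. \<gamma> n \<cdot> \<iota> n = Zero C (ob E n) (ob A n)"
      using gz by (auto simp: fun_eq_iff)
    then have "\<forall>n. \<exists>u. u \<in> Hom C (ob T n) (ob A n) \<and> u \<cdot> \<pi> n = \<gamma> n"
      using cokernel_factor[OF coker] invseq_morD[OF \<gamma>(2)] I P by (metis in_Hom)
    then obtain u where u: "\<And>n. u n \<in> Hom C (ob T n) (ob A n)" "\<And>n. u n \<cdot> \<pi> n = \<gamma> n" by metis
    have uA: "u n \<in> Arr C" "Dom C (u n) = ob T n" "Cod C (u n) = ob A n" for n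
      using u(1)[of n] by (auto simp: in_Hom)
    have A: "inverse_sequence C A" using \<gamma> by (simp add: invseq_mor_def)
    note BA = inverse_sequenceD[OF A]
    have "u n \<cdot> bond T n = bond A n \<cdot> u (Suc n)" for n
    proof -
      have "(u n \<cdot> bond T n) \<cdot> \<pi> (Suc n) = u n \<cdot> (bond T n \<cdot> \<pi> (Suc n))"
        using uA P(1-3) BT by simp
      also have "\<dots> = (u n \<cdot> \<pi> n) \<cdot> bond S n"
        unfolding P(4)[symmetric] using uA P(1-3) BS by simp
      also have "\<dots> = bond A n \<cdot> (u (Suc n) \<cdot> \<pi> (Suc n))"
        unfolding u(2) using invseq_morD[OF \<gamma>(2)] by simp
      also have "\<dots> = (bond A n \<cdot> u (Suc n)) \<cdot> \<pi> (Suc n)"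
        using uA P(1-3) BA by simp
      finally show ?thesis
        using epicD[OF cokernel_epic[OF coker[of "Suc n"]], of "u n \<cdot> bond T n" "ob A n"
          "bond A n \<cdot> u (Suc n)"]
          uA BA BT P(3) by (simp add: in_Hom)
    qed
    then have "invseq_mor C T u A"
      using u A invs by (simp add: invseq_mor_def)
    then show ?thesis
      using u \<gamma> by (intro bexI[of _ "(T, u, A)"]) simp_all
  qed
  ultimately show ?thesis
    unfolding short_exact_def using i p z
    by (intro conjI D.is_kernelI D.is_cokernelI) simp_all
qed

text \<open>\<open>is_shift_difference\<close> hides the product, its projections and
  \<open>F\<close> behind an existential quantifier; here they are named so that coordinates can be
  computed.\<close>

definition shift_data :: "('a, 'b) invseq \<Rightarrow> 'a \<Rightarrow> (nat \<Rightarrow> 'b) \<Rightarrow> 'b \<Rightarrow> bool" where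
  "shift_data S P pr F \<longleftrightarrow> inverse_sequence C S \<and> is_product C UNIV (ob S) P pr \<and>
    F \<in> Hom C P P \<and> (\<forall>j. pr j \<cdot> F = bond S j \<cdot> pr (Suc j))"

abbreviation one_minus :: "'a \<Rightarrow> 'b \<Rightarrow> 'b" where
  "one_minus P F \<equiv> Diff C (Ident C P) F"

lemma is_shift_difference_iff:
  "inverse_sequence C S \<Longrightarrow>
    is_shift_difference C S d \<longleftrightarrow> (\<exists>P pr F. shift_data S P pr F \<and> d = one_minus P F)"
  by (auto simp: is_shift_difference_def shift_data_def)

lemma shift_dataD:
  assumes "shift_data S P pr F"
  shows "inverse_sequence C S" "is_product C UNIV (ob S) P pr" "P \<in> Obj C"
    "F \<in> Arr C" "Dom C F = P" "Cod C F = P" "pr n \<in> Arr C" "Dom C (pr n) = P" "Cod C (pr n) = ob S n"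
    "pr n \<cdot> F = bond S n \<cdot> pr (Suc n)"
  using assms by (auto simp: shift_data_def is_product_def in_Hom)

lemma one_minus_Hom:
  assumes "shift_data S P pr F"
  shows "one_minus P F \<in> Hom C P P"
  using shift_dataD[OF assms] by (simp add: in_Hom)

lemma proj_one_minus:
  assumes "shift_data S P pr F" "u \<in> Hom C X P"
  shows "pr n \<cdot> (one_minus P F \<cdot> u) = Diff C (pr n \<cdot> u) (bond S n \<cdot> (pr (Suc n) \<cdot> u))"
proof -
  note D = shift_dataD[OF assms(1)] and B = inverse_sequenceD[OF shift_dataD(1)[OF assms(1)]]
  have u: "u \<in> Arr C" "Dom C u = X" "Cod C u = P" using assms(2) by (auto simp: in_Hom)
  have "pr n \<cdot> (one_minus P F \<cdot> u) = Diff C (pr n \<cdot> u) (pr n \<cdot> (F \<cdot> u))"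
    using D u by (simp add: Diff_Comp Comp_Diff)
  also have "pr n \<cdot> (F \<cdot> u) = (pr n \<cdot> F) \<cdot> u"
    using D(3-9) u by simp
  also have "\<dots> = bond S n \<cdot> (pr (Suc n) \<cdot> u)"
    unfolding D(10) using D(3-9) u B by simp
  finally show ?thesis .
qed

text \<open>The coordinates of \<open>(1 - F) u\<close> are the differences
  \<open>u n - f u (Suc n)\<close>, so maps into the kernel of \<open>1 - F\<close> are the same as
  threads.\<close>

lemma one_minus_zero_iff:
  assumes "shift_data S P pr F" "u \<in> Hom C X P"
  shows "one_minus P F \<cdot> u = Zero C X P \<longleftrightarrow> thread C S X (\<lambda>n. pr n \<cdot> u)"
proof -
  note D = shift_dataD[OF assms(1)] and B = inverse_sequenceD[OF shift_dataD(1)[OF assms(1)]]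
  have u: "u \<in> Arr C" "Dom C u = X" "Cod C u = P" "X \<in> Obj C"
    using assms(2) Hom_Obj by (auto simp: in_Hom)
  have d: "one_minus P F \<in> Arr C" "Dom C (one_minus P F) = P" "Cod C (one_minus P F) = P"
    using one_minus_Hom[OF assms(1)] by (auto simp: in_Hom)
  have "pr n \<cdot> (one_minus P F \<cdot> u) = Zero C X (ob S n) \<longleftrightarrow>
      bond S n \<cdot> (pr (Suc n) \<cdot> u) = pr n \<cdot> u" for n
    unfolding proj_one_minus[OF assms]
    using Diff_eq_Zero_iff[of "pr n \<cdot> u" "bond S n \<cdot> (pr (Suc n) \<cdot> u)"] D u B by auto
  then have "thread C S X (\<lambda>n. pr n \<cdot> u) \<longleftrightarrow>
      (\<forall>n. pr n \<cdot> (one_minus P F \<cdot> u) = pr n \<cdot> Zero C X P)"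
    using D u by (simp add: thread_def in_Hom)
  also have "\<dots> \<longleftrightarrow> one_minus P F \<cdot> u = Zero C X P"
    using product_eqI[OF D(2), of "one_minus P F \<cdot> u" X "Zero C X P"] D(3) d u by (auto simp: in_Hom)
  finally show ?thesis by blast
qed

end

section \<open>Limits\<close>

context ab4star_category
begin

lemma shift_data_ex:
  assumes "inverse_sequence C S"
  obtains P pr F where "shift_data S P pr F"
proof -
  note B = inverse_sequenceD[OF assms]
  obtain P pr where P: "is_product C UNIV (ob S) P pr"
    using product_ex[OF small_nat[OF inaccessible], of "ob S"] B(1) by metis
  then have pr: "P \<in> Obj C" "\<And>n. pr n \<in> Hom C P (ob S n)"
    by (auto simp: is_product_def)
  have "\<And>n. bond S n \<cdot> pr (Suc n) \<in> Hom C P (ob S n)"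
    using B pr by (simp add: in_Hom)
  then obtain F where "F \<in> Hom C P P" "\<And>n. pr n \<cdot> F = bond S n \<cdot> pr (Suc n)"
    using product_map[OF P _ pr(1), of "\<lambda>n. bond S n \<cdot> pr (Suc n)"] by auto
  then show thesis
    using that assms P unfolding shift_data_def by blast
qed

lemma kernel_one_minus_universal:
  assumes S: "shift_data S P pr F" and k: "is_kernel C k (one_minus P F)"
  shows "thread C S (Dom C k) (\<lambda>n. pr n \<cdot> k)"
    and "thread C S X t \<Longrightarrow> \<exists>w \<in> Hom C X (Dom C k). \<forall>n. (pr n \<cdot> k) \<cdot> w = t n"
proof -
  note D = shift_dataD[OF S]
  have d: "one_minus P F \<in> Arr C" "Dom C (one_minus P F) = P" "Cod C (one_minus P F) = P"
    using one_minus_Hom[OF S] by (auto simp: in_Hom)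
  have kA: "k \<in> Hom C (Dom C k) P" "one_minus P F \<cdot> k = Zero C (Dom C k) P"
    using k d by (auto simp: is_kernel_def in_Hom)
  show "thread C S (Dom C k) (\<lambda>n. pr n \<cdot> k)"
    using one_minus_zero_iff[OF S kA(1)] kA(2) by blast
  assume t: "thread C S X t"
  obtain u where u: "u \<in> Hom C X P" "\<And>n. pr n \<cdot> u = t n"
    using product_map[OF D(2), of t X] t thread_Obj[OF t] by (auto simp: thread_def)
  have "one_minus P F \<cdot> u = Zero C X P"
    using one_minus_zero_iff[OF S u(1)] t u(2) by simp
  then obtain w where w: "w \<in> Hom C X (Dom C k)" "k \<cdot> w = u"
    using kernel_factor[OF k, of u X] u(1) d by auto
  have "(pr n \<cdot> k) \<cdot> w = t n" for n
    using w u(2)[of n] kA(1) D by (simp add: in_Hom)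
  then show "\<exists>w \<in> Hom C X (Dom C k). \<forall>n. (pr n \<cdot> k) \<cdot> w = t n"
    using w by blast
qed

lemma limit_ex:
  assumes "inverse_sequence C S"
  obtains L l where "thread C S L l"
    "\<And>X t. thread C S X t \<Longrightarrow> \<exists>w \<in> Hom C X L. \<forall>n. l n \<cdot> w = t n"
proof -
  obtain P pr F where S: "shift_data S P pr F"
    using shift_data_ex[OF assms] .
  obtain k where k: "is_kernel C k (one_minus P F)"
    using kernel_ex one_minus_Hom[OF S] by (auto simp: in_Hom)
  show thesis
    using that[of "Dom C k" "\<lambda>n. pr n \<cdot> k"] kernel_one_minus_universal[OF S k] by blast
qed

text \<open>Every thread factors through the kernel of \<open>1 - F\<close>, and that kernel carries
  a thread itself. This replaces the object picked by \<open>SOME\<close> with a condition on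
  threads.\<close>

lemma Lim_obj_zero_iff:
  assumes "inverse_sequence C S"
  shows "zero_object C (Lim_obj C S) \<longleftrightarrow>
    (\<forall>X t. thread C S X t \<longrightarrow> (\<forall>n. t n = Zero C X (ob S n)))"
proof -
  obtain P pr F where "shift_data S P pr F"
    using shift_data_ex[OF assms] .
  then have "\<exists>L. is_Lim C S L"
    using kernel_ex one_minus_Hom is_shift_difference_iff[OF assms]
    unfolding is_Lim_def by (metis in_Hom)
  then have "is_Lim C S (Lim_obj C S)"
    unfolding Lim_obj_def by (rule someI_ex)
  \<comment> \<open>The product used so far only shows that some limit exists; the one behind
    \<open>Lim_obj\<close> may be different and is unpacked here.\<close>
  then obtain P pr F k where S: "shift_data S P pr F" and k: "is_kernel C k (one_minus P F)"
    and L: "Lim_obj C S = Dom C k"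
    using is_shift_difference_iff[OF assms] unfolding is_Lim_def by metis
  note D = shift_dataD[OF S]
  have kA: "k \<in> Arr C" "Cod C k = P"
    using k one_minus_Hom[OF S] by (auto simp: is_kernel_def in_Hom)
  have LO: "Dom C k \<in> Obj C" using kA Dom_Obj by blast
  note thr = kernel_one_minus_universal[OF S k]
  show ?thesis
  proof
    assume z: "zero_object C (Lim_obj C S)"
    show "\<forall>X t. thread C S X t \<longrightarrow> (\<forall>n. t n = Zero C X (ob S n))"
    proof (intro allI impI)
      fix X t n assume t: "thread C S X t"
      then obtain w where w: "w \<in> Hom C X (Dom C k)" "(pr n \<cdot> k) \<cdot> w = t n"
        using thr(2) by blast
      have "Zero C X (Dom C k) \<in> Hom C X (Dom C k)"
        using LO thread_Obj[OF t] by (simp add: in_Hom)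
      then have "w = Zero C X (Dom C k)"
        using z w(1) thread_Obj[OF t] unfolding L zero_object_def by blast
      then show "t n = Zero C X (ob S n)"
        using w(2) kA D thread_Obj[OF t] LO by simp
    qed
  next
    assume z: "\<forall>X t. thread C S X t \<longrightarrow> (\<forall>n. t n = Zero C X (ob S n))"
    then have pz: "pr n \<cdot> k = Zero C (Dom C k) (ob S n)" for n
      using thr(1) by blast
    have "k = Zero C (Dom C k) P"
      by (rule product_eqI[OF D(2)]) (use kA D LO pz in \<open>simp_all add: in_Hom\<close>)
    \<comment> \<open>As \<open>k\<close> is both zero and monic, the identity of its domain is
      zero.\<close>
    then have "k \<cdot> Ident C (Dom C k) = k \<cdot> Zero C (Dom C k) (Dom C k)"
      using kA LO by simp
    then have id: "Ident C (Dom C k) = Zero C (Dom C k) (Dom C k)"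
      using monicD[OF kernel_monic[OF k], of "Ident C (Dom C k)" "Dom C k"] LO by (simp add: in_Hom)
    have "f = Zero C a (Dom C k)" if "f \<in> Hom C a (Dom C k)" for a f
      using Ident_Comp[OF that] that unfolding id using LO by (simp add: in_Hom)
    moreover have "f = Zero C (Dom C k) a" if "f \<in> Hom C (Dom C k) a" for a f
      using Comp_Ident[OF that] that unfolding id using LO by (simp add: in_Hom)
    moreover have "Zero C a b \<in> Hom C a b" if "a \<in> Obj C" "b \<in> Obj C" for a b
      using that by (simp add: in_Hom)
    ultimately show "zero_object C (Lim_obj C S)"
      unfolding L zero_object_def using LO by metis
  qed
qed

section \<open>Consequences of lifting for epimorphic sequences\<close>

lemma epimorphic_one_minus_epic:
  assumes S: "shift_data E P pr F" and epi: "epimorphic C E"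
  shows "epic C (one_minus P F)"
proof (rule epicI_generator[OF one_minus_Hom[OF S]])
  note D = shift_dataD[OF S] and B = inverse_sequenceD[OF shift_dataD(1)[OF S]]
  fix x assume x: "x \<in> Hom C G P"
  \<comment> \<open>With the coordinates of \<open>x\<close> as inhomogeneous terms, the recursion
    reads \<open>(1 - F) u = x p\<close>. The prescribed zeroth value in
    \<open>thread_lifting\<close> is satisfied with zero.\<close>
  have a: "\<And>n. pr n \<cdot> x \<in> Hom C G (ob E n)" and z: "Zero C G (ob E 0) \<in> Hom C G (ob E 0)"
    using D x G_Obj B by (simp_all add: in_Hom)
  obtain Q p y where p: "p \<in> Hom C Q G" "epic C p" and y: "\<And>n. y n \<in> Hom C Q (ob E n)"
    and yy: "\<And>n. y n = Add C (bond E n \<cdot> y (Suc n)) ((pr n \<cdot> x) \<cdot> p)"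
    using thread_lifting[OF D(1) epi a z] by metis
  have Q: "Q \<in> Obj C" using p Hom_Obj by blast
  obtain u where u: "u \<in> Hom C Q P" "\<And>n. pr n \<cdot> u = y n"
    using product_map[OF D(2), of y Q] y Q by auto
  have "one_minus P F \<cdot> u = x \<cdot> p"
  proof (rule product_eqI[OF D(2)])
    show "one_minus P F \<cdot> u \<in> Hom C Q P" "x \<cdot> p \<in> Hom C Q P"
      using Comp_Hom u(1) one_minus_Hom[OF S] x p(1) by blast+
    fix n
    have yA: "y n \<in> Arr C" "Dom C (y n) = Q" "Cod C (y n) = ob E n" for n
      using y[of n] by (auto simp: in_Hom)
    have "y n = Add C ((pr n \<cdot> x) \<cdot> p) (bond E n \<cdot> y (Suc n))"
      using yy[of n] Add_commute[of "bond E n \<cdot> y (Suc n)" "(pr n \<cdot> x) \<cdot> p"] yA B D x p(1)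
      by (simp add: in_Hom)
    then have "Diff C (y n) (bond E n \<cdot> y (Suc n)) = (pr n \<cdot> x) \<cdot> p"
      using Diff_eq_iff[of "y n" "bond E n \<cdot> y (Suc n)" "(pr n \<cdot> x) \<cdot> p"] yA B D x p(1)
      by (simp add: in_Hom)
    then show "pr n \<cdot> (one_minus P F \<cdot> u) = pr n \<cdot> (x \<cdot> p)"
      unfolding proj_one_minus[OF S u(1)] u(2) using D x p(1) by (simp add: in_Hom)
  qed
  then show "\<exists>Q p y. p \<in> Hom C Q G \<and> epic C p \<and> y \<in> Hom C Q P \<and> one_minus P F \<cdot> y = x \<cdot> p"
    using p u by blast
qed

text \<open>After a cover, any \<open>x\<close> from \<open>G\<close> to \<open>E 0\<close> starts a
  thread of \<open>E\<close>, whose image is a thread of \<open>T\<close> and so vanishes; the cover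
  cancels. Later components reduce to this by dropping initial terms, which is why the induction
  generalizes over the sequences.\<close>

lemma epimorphic_to_lim_zero:
  assumes "invseq_mor C E \<phi> T" "epimorphic C E"
    and "\<And>X t n. thread C T X t \<Longrightarrow> t n = Zero C X (ob T n)"
  shows "\<phi> n = Zero C (ob E n) (ob T n)"
  using assms
proof (induction n arbitrary: E \<phi> T)
  case 0
  note M = invseq_morD[OF 0(1)]
  have invs: "inverse_sequence C E" "inverse_sequence C T"
    using 0(1) by (auto simp: invseq_mor_def)
  note BE = inverse_sequenceD[OF invs(1)] and BT = inverse_sequenceD[OF invs(2)]
  show ?case
  proof (rule generator_eqI)
    show "\<phi> 0 \<in> Hom C (ob E 0) (ob T 0)"
      "Zero C (ob E 0) (ob T 0) \<in> Hom C (ob E 0) (ob T 0)"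
      using M BE BT by (simp_all add: in_Hom)
    fix x assume x: "x \<in> Hom C G (ob E 0)"
    \<comment> \<open>With zero inhomogeneous terms the solution is a genuine thread.\<close>
    have a: "\<And>n. Zero C G (ob E n) \<in> Hom C G (ob E n)"
      using BE G_Obj by (simp add: in_Hom)
    obtain Q p y where p: "p \<in> Hom C Q G" "epic C p" and y: "\<And>n. y n \<in> Hom C Q (ob E n)"
      and y0: "y 0 = x \<cdot> p" and yy: "\<And>n. y n = Add C (bond E n \<cdot> y (Suc n)) (Zero C G (ob E n) \<cdot> p)"
      using thread_lifting[OF invs(1) 0(2) a x] by metis
    have yA: "y n \<in> Arr C" "Dom C (y n) = Q" "Cod C (y n) = ob E n" for n
      using y[of n] by (auto simp: in_Hom)
    have "bond E n \<cdot> y (Suc n) = y n" for n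
      using yy[of n] p(1) yA BE by (simp add: in_Hom)
    then have "bond T n \<cdot> (\<phi> (Suc n) \<cdot> y (Suc n)) = \<phi> n \<cdot> y n" for n
      using Comp_assoc_Arr[of "y (Suc n)" "\<phi> (Suc n)" "bond T n"]
        Comp_assoc_Arr[of "y (Suc n)" "bond E n" "\<phi> n"] M yA BE BT by simp
    then have "thread C T Q (\<lambda>n. \<phi> n \<cdot> y n)"
      using M yA by (simp add: thread_def in_Hom)
    then have "\<phi> 0 \<cdot> (x \<cdot> p) = Zero C Q (ob T 0)"
      using 0(3)[of Q "\<lambda>n. \<phi> n \<cdot> y n" 0] y0 by simp
    then have "\<phi> 0 \<cdot> x = Zero C G (ob T 0)"
      using epic_zeroD[OF p(2), of "\<phi> 0 \<cdot> x" "ob T 0"] M x p(1) by (simp add: in_Hom)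
    then show "\<phi> 0 \<cdot> x = Zero C (ob E 0) (ob T 0) \<cdot> x"
      using x BT by (simp add: in_Hom)
  qed
next
  case (Suc n)
  note M = invseq_morD[OF Suc.prems(1)]
  define tail where "tail S = \<lparr>ob = \<lambda>n. ob S (Suc n), bond = \<lambda>n. bond S (Suc n)\<rparr>"
    for S :: "('o, 'm) invseq"
  have tail: "ob (tail S) n = ob S (Suc n)" "bond (tail S) n = bond S (Suc n)" for S n
    by (simp_all add: tail_def)
  have T: "inverse_sequence C T" using Suc.prems(1) by (auto simp: invseq_mor_def)
  note BT = inverse_sequenceD[OF T]
  have "\<phi> (Suc n) = Zero C (ob (tail E) n) (ob (tail T) n)"
  proof (rule Suc.IH[of "tail E" "\<lambda>n. \<phi> (Suc n)" "tail T"])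
    show "invseq_mor C (tail E) (\<lambda>n. \<phi> (Suc n)) (tail T)"
      using Suc.prems(1) by (auto simp: invseq_mor_def inverse_sequence_def tail)
    show "epimorphic C (tail E)"
      using Suc.prems(2) by (simp add: epimorphic_def tail)
    fix X t n assume t: "thread C (tail T) X t"
    note tD = threadD[OF t, unfolded tail]
    \<comment> \<open>A thread of the tail extends to \<open>T\<close> by applying the first bond,
      so the tail again has only zero threads.\<close>
    have "thread C T X (\<lambda>n. case n of 0 \<Rightarrow> bond T 0 \<cdot> t 0 | Suc m \<Rightarrow> t m)"
      using tD BT by (auto simp: thread_def in_Hom split: nat.split)
    then show "t n = Zero C X (ob (tail T) n)"
      using Suc.prems(3)[of X _ "Suc n"] by (simp add: tail)
  qed
  then show ?case by (simp add: tail)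
qed

text \<open>Since \<open>lim\<^sup>1 E = 0\<close>, threads of \<open>T\<close> lift to threads of \<open>S\<close> after passing to a cover.\<close>

lemma thread_lifting_along_epi:
  assumes i: "invseq_mor C E \<iota> S" and p: "invseq_mor C S \<pi> T"
    and ex: "\<And>n. short_exact C (\<iota> n) (\<pi> n)" and epi: "epimorphic C E"
    and t: "thread C T X t"
  obtains R q y where "q \<in> Hom C R X" "epic C q" "thread C S R y" "\<And>n. \<pi> n \<cdot> y n = t n \<cdot> q"
proof -
  note I = invseq_morD[OF i] and P = invseq_morD[OF p]
  have invs: "inverse_sequence C E" "inverse_sequence C S" "inverse_sequence C T"
    using i p by (auto simp: invseq_mor_def)
  note BE = inverse_sequenceD[OF invs(1)] and BS = inverse_sequenceD[OF invs(2)]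
    and BT = inverse_sequenceD[OF invs(3)]
  have ker: "is_kernel C (\<iota> n) (\<pi> n)" and coker: "is_cokernel C (\<pi> n) (\<iota> n)" for n
    using ex[of n] by (auto simp: short_exact_def)
  have zero: "\<pi> n \<cdot> \<iota> n = Zero C (ob E n) (ob T n)" for n
    using ker[of n] I(2)[of n] P(3)[of n] by (simp add: is_kernel_def)
  obtain PE prE FE where SE: "shift_data E PE prE FE" using shift_data_ex[OF invs(1)] .
  obtain PS prS FS where SS: "shift_data S PS prS FS" using shift_data_ex[OF invs(2)] .
  obtain PT prT FT where ST: "shift_data T PT prT FT" using shift_data_ex[OF invs(3)] .
  note DE = shift_dataD[OF SE] and DS = shift_dataD[OF SS] and DT = shift_dataD[OF ST]
  have X: "X \<in> Obj C" using thread_Obj[OF t] .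
  note tD = threadD[OF t]
  obtain v where v: "v \<in> Hom C PS PT" "\<And>n. prT n \<cdot> v = \<pi> n \<cdot> prS n"
    using product_map[OF DT(2) _ DS(3), of "\<lambda>n. \<pi> n \<cdot> prS n"] P DS by (auto simp: in_Hom)
  have "epic C v"
    by (rule product_epic[OF small_nat[OF inaccessible] _ DS(2) DT(2) v])
      (use P cokernel_epic[OF coker] in \<open>simp add: in_Hom\<close>)
  obtain \<tau> where \<tau>: "\<tau> \<in> Hom C X PT" "\<And>n. prT n \<cdot> \<tau> = t n"
    using product_map[OF DT(2) _ X, of t] tD by (auto simp: in_Hom)
  obtain Q q z where q: "q \<in> Hom C Q X" "epic C q" "z \<in> Hom C Q PS" "v \<cdot> z = \<tau> \<cdot> q"
    using epic_pullback[OF \<open>epic C v\<close> v(1) \<tau>(1)] .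
  have qA: "q \<in> Arr C" "Dom C q = Q" "Cod C q = X" "Q \<in> Obj C"
    using q(1) Hom_Obj by (auto simp: in_Hom)
  \<comment> \<open>\<open>x\<close> lifts \<open>t\<close> in each coordinate, but it need not be a
    thread.\<close>
  define x where "x n = prS n \<cdot> z" for n
  have x: "x n \<in> Arr C" "Dom C (x n) = Q" "Cod C (x n) = ob S n" for n
    using q(3) DS by (auto simp: x_def in_Hom)
  have \<pi>x: "\<pi> n \<cdot> x n = t n \<cdot> q" for n
  proof -
    have "\<pi> n \<cdot> x n = (prT n \<cdot> v) \<cdot> z"
      unfolding v(2) x_def using P DS q(3) by (simp add: in_Hom)
    also have "\<dots> = prT n \<cdot> (\<tau> \<cdot> q)"
      using q v(1) DT by (simp add: in_Hom)
    also have "\<dots> = (prT n \<cdot> \<tau>) \<cdot> q"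
      using q(1) \<tau>(1) DT by (simp add: in_Hom)
    finally show ?thesis unfolding \<tau>(2) .
  qed
  \<comment> \<open>The defect of \<open>x\<close>. It is killed by \<open>\<pi>\<close> because
    \<open>t\<close> is a thread, so it comes from a family \<open>c\<close> in
    \<open>E\<close>.\<close>
  define b where "b n = Diff C (x n) (bond S n \<cdot> x (Suc n))" for n
  have b: "b n \<in> Arr C" "Dom C (b n) = Q" "Cod C (b n) = ob S n" for n
    using x BS by (auto simp: b_def)
  have "\<pi> n \<cdot> b n = Zero C Q (ob T n)" for n
  proof -
    have "\<pi> n \<cdot> (bond S n \<cdot> x (Suc n)) = (\<pi> n \<cdot> bond S n) \<cdot> x (Suc n)"
      using P(1-3) BS x by simp
    also have "\<dots> = bond T n \<cdot> (\<pi> (Suc n) \<cdot> x (Suc n))"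
      unfolding P(4) using P(1-3) BT x by simp
    also have "\<dots> = (bond T n \<cdot> t (Suc n)) \<cdot> q"
      unfolding \<pi>x using tD(1-3) qA BT by simp
    also have "\<dots> = \<pi> n \<cdot> x n"
      unfolding tD(4) \<pi>x ..
    finally have "\<pi> n \<cdot> (bond S n \<cdot> x (Suc n)) = \<pi> n \<cdot> x n" .
    then show ?thesis
      using Diff_eq_Zero_iff[of "\<pi> n \<cdot> x n" "\<pi> n \<cdot> x n"] P BS x
      by (simp add: b_def Comp_Diff)
  qed
  then have "\<forall>n. \<exists>c. c \<in> Hom C Q (ob E n) \<and> \<iota> n \<cdot> c = b n"
    using kernel_factor[OF ker] b I P by (metis in_Hom)
  then obtain c where c: "\<And>n. c n \<in> Hom C Q (ob E n)" "\<And>n. \<iota> n \<cdot> c n = b n" by metis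
  obtain \<beta> where \<beta>: "\<beta> \<in> Hom C Q PE" "\<And>n. prE n \<cdot> \<beta> = c n"
    using product_map[OF DE(2) _ qA(4), of c] c(1) by auto
  \<comment> \<open>Over a further cover the defect \<open>c\<close> has the form
    \<open>(1 - F) e\<close>.\<close>
  obtain R r w where r: "r \<in> Hom C R Q" "epic C r" "w \<in> Hom C R PE"
    "one_minus PE FE \<cdot> w = \<beta> \<cdot> r"
    using epic_pullback[OF epimorphic_one_minus_epic[OF SE epi] one_minus_Hom[OF SE] \<beta>(1)] .
  have rA: "r \<in> Arr C" "Dom C r = R" "Cod C r = Q" "R \<in> Obj C"
    using r(1) Hom_Obj by (auto simp: in_Hom)
  define e where "e n = prE n \<cdot> w" for n
  have e: "e n \<in> Arr C" "Dom C (e n) = R" "Cod C (e n) = ob E n" for n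
    using r(3) DE by (auto simp: e_def in_Hom)
  have ce: "c n \<cdot> r = Diff C (e n) (bond E n \<cdot> e (Suc n))" for n
  proof -
    have "c n \<cdot> r = prE n \<cdot> (one_minus PE FE \<cdot> w)"
      unfolding \<beta>(2)[symmetric] r(4) using DE \<beta>(1) rA by (simp add: in_Hom)
    then show ?thesis
      unfolding proj_one_minus[OF SE r(3)] e_def .
  qed
  \<comment> \<open>Subtracting \<open>e\<close> cancels the defect of \<open>x\<close> and does not
    change the image in \<open>T\<close>.\<close>
  define y where "y n = Diff C (x n \<cdot> r) (\<iota> n \<cdot> e n)" for n
  have y: "y n \<in> Arr C" "Dom C (y n) = R" "Cod C (y n) = ob S n" for n
    using x rA I e by (auto simp: y_def)
  have "bond S n \<cdot> y (Suc n) = y n" for n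
  proof -
    have "bond S n \<cdot> (\<iota> (Suc n) \<cdot> e (Suc n)) = (bond S n \<cdot> \<iota> (Suc n)) \<cdot> e (Suc n)"
      using BS I(1-3) e by simp
    also have "\<dots> = \<iota> n \<cdot> (bond E n \<cdot> e (Suc n))"
      unfolding I(4)[symmetric] using BE I(1-3) e by simp
    finally have bond_y: "bond S n \<cdot> y (Suc n) =
        Diff C (bond S n \<cdot> (x (Suc n) \<cdot> r)) (\<iota> n \<cdot> (bond E n \<cdot> e (Suc n)))"
      using BS x rA I e by (simp add: y_def Comp_Diff)
    have "Diff C (y n) (bond S n \<cdot> y (Suc n)) =
        Diff C (Diff C (x n \<cdot> r) (bond S n \<cdot> (x (Suc n) \<cdot> r)))
          (Diff C (\<iota> n \<cdot> e n) (\<iota> n \<cdot> (bond E n \<cdot> e (Suc n))))"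
      unfolding bond_y unfolding y_def
      by (rule Diff_Diff_swap[of _ R "ob S n"]) (use x rA BS BE I e in \<open>simp_all add: in_Hom\<close>)
    also have "\<dots> = Diff C (b n \<cdot> r) (\<iota> n \<cdot> (c n \<cdot> r))"
      unfolding ce b_def using x rA BS BE I e by (simp add: Comp_Diff Diff_Comp)
    also have "\<iota> n \<cdot> (c n \<cdot> r) = b n \<cdot> r"
      unfolding c(2)[symmetric] using I c(1)[of n] rA by (simp add: in_Hom)
    also have "Diff C (b n \<cdot> r) (b n \<cdot> r) = Zero C R (ob S n)"
      using Diff_eq_Zero_iff[of "b n \<cdot> r" "b n \<cdot> r"] b rA by simp
    finally show ?thesis
      using Diff_eq_Zero_iff[of "y n" "bond S n \<cdot> y (Suc n)"] y BS by simp
  qed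
  then have thr: "thread C S R y"
    using y by (simp add: thread_def in_Hom)
  have "\<pi> n \<cdot> y n = t n \<cdot> (q \<cdot> r)" for n
  proof -
    have "\<pi> n \<cdot> (\<iota> n \<cdot> e n) = Zero C R (ob T n)"
      using Comp_assoc_Arr[of "e n" "\<iota> n" "\<pi> n"] zero[of n] I P e BT by simp
    then have "\<pi> n \<cdot> y n = Diff C (\<pi> n \<cdot> (x n \<cdot> r)) (Zero C R (ob T n))"
      using x rA I e P by (simp add: y_def Comp_Diff)
    also have "\<dots> = \<pi> n \<cdot> (x n \<cdot> r)"
      using Diff_eq_iff[of "\<pi> n \<cdot> (x n \<cdot> r)" "Zero C R (ob T n)" "\<pi> n \<cdot> (x n \<cdot> r)"] x rA P BT
      by simp
    also have "\<dots> = (\<pi> n \<cdot> x n) \<cdot> r"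
      using x rA P by simp
    also have "\<dots> = t n \<cdot> (q \<cdot> r)"
      unfolding \<pi>x using tD qA rA by simp
    finally show ?thesis .
  qed
  moreover have "epic C (q \<cdot> r)" "q \<cdot> r \<in> Hom C R X"
    using epic_Comp[OF r(2) q(2)] qA rA by (simp_all add: in_Hom)
  ultimately show thesis using that thr by blast
qed

section \<open>Existence of the sequence\<close>

lemma epimorphic_lim_zero_ex:
  assumes S: "inverse_sequence C S"
  obtains E \<iota> \<pi> T where "invseq_mor C E \<iota> S" "invseq_mor C S \<pi> T"
    "\<And>n. short_exact C (\<iota> n) (\<pi> n)" "epimorphic C E"
    "\<And>X t n. thread C T X t \<Longrightarrow> t n = Zero C X (ob T n)"
proof -
  note BS = inverse_sequenceD[OF S]
  obtain L l where l: "thread C S L l"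
    and univ: "\<And>X t. thread C S X t \<Longrightarrow> \<exists>w \<in> Hom C X L. \<forall>n. l n \<cdot> w = t n"
    using limit_ex[OF S] by metis
  note lD = threadD[OF l]
  \<comment> \<open>All image data at \<open>n\<close> in one relation, so that the functions
    \<open>I\<close>, \<open>e\<close>, \<open>\<iota>\<close>, \<open>\<pi>\<close> can be chosen
    one after another.\<close>
  define R where "R n I e m c \<longleftrightarrow> e \<in> Hom C L I \<and> epic C e \<and> m \<in> Hom C I (ob S n) \<and>
    c \<in> Hom C (ob S n) (Cod C c) \<and> short_exact C m c \<and> m \<cdot> e = l n" for n I e m c
  have "\<exists>I e m c. R n I e m c" for n
    using image_factorization[of "l n" L "ob S n"] lD unfolding R_def by (metis in_Hom)
  then obtain I where "\<And>n. \<exists>e m c. R n (I n) e m c" by metis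
  then obtain e where "\<And>n. \<exists>m c. R n (I n) (e n) m c" by metis
  then obtain \<iota> where "\<And>n. \<exists>c. R n (I n) (e n) (\<iota> n) c" by metis
  then obtain \<pi> where "\<And>n. R n (I n) (e n) (\<iota> n) (\<pi> n)" by metis
  then have e: "e n \<in> Arr C" "Dom C (e n) = L" "Cod C (e n) = I n" "epic C (e n)"
    and \<iota>: "\<iota> n \<in> Arr C" "Dom C (\<iota> n) = I n" "Cod C (\<iota> n) = ob S n"
    and \<pi>: "\<pi> n \<in> Arr C" "Dom C (\<pi> n) = ob S n"
    and ex: "short_exact C (\<iota> n) (\<pi> n)" and \<iota>e: "\<iota> n \<cdot> e n = l n" for n
    unfolding R_def by (simp_all add: in_Hom)
  have ker: "is_kernel C (\<iota> n) (\<pi> n)" and coker: "is_cokernel C (\<pi> n) (\<iota> n)" for n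
    using ex[of n] by (auto simp: short_exact_def)
  have zero: "\<pi> n \<cdot> \<iota> n = Zero C (I n) (Cod C (\<pi> n))" for n
    using ker[of n] \<iota>[of n] by (simp add: is_kernel_def)
  have Obj: "L \<in> Obj C" "I n \<in> Obj C" "Cod C (\<pi> n) \<in> Obj C" for n
    using thread_Obj[OF l] \<iota>[of n] \<pi>[of n] Dom_Obj[of "\<iota> n"] Cod_Obj[of "\<pi> n"] by auto
  have \<pi>l: "\<pi> n \<cdot> l n = Zero C L (Cod C (\<pi> n))" for n
    using Comp_assoc_Arr[of "e n" "\<iota> n" "\<pi> n"] zero[of n] \<iota>e[of n] e \<iota> \<pi> Obj by simp
  \<comment> \<open>Checked after the epic \<open>e (Suc n)\<close>, where it becomes
    \<open>\<pi> n \<cdot> l n = 0\<close> since \<open>l\<close> is a thread. It yields both the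
    bonds of \<open>E\<close>, through the kernels, and those of \<open>T\<close>, through the
    cokernels.\<close>
  have \<pi>f\<iota>: "\<pi> n \<cdot> (bond S n \<cdot> \<iota> (Suc n)) = Zero C (I (Suc n)) (Cod C (\<pi> n))" for n
  proof -
    have "(\<pi> n \<cdot> (bond S n \<cdot> \<iota> (Suc n))) \<cdot> e (Suc n) = \<pi> n \<cdot> (bond S n \<cdot> l (Suc n))"
      unfolding \<iota>e[symmetric] using e \<iota> \<pi> BS by simp
    also have "\<dots> = Zero C L (Cod C (\<pi> n))"
      unfolding lD(4) \<pi>l ..
    finally show ?thesis
      using epic_zeroD[OF e(4)[of "Suc n"], of "\<pi> n \<cdot> (bond S n \<cdot> \<iota> (Suc n))" "Cod C (\<pi> n)"]
        e \<iota> \<pi> BS by (simp add: in_Hom)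
  qed
  have "\<forall>n. \<exists>f. f \<in> Hom C (I (Suc n)) (I n) \<and> \<iota> n \<cdot> f = bond S n \<cdot> \<iota> (Suc n)"
  proof
    fix n
    have "bond S n \<cdot> \<iota> (Suc n) \<in> Hom C (I (Suc n)) (Dom C (\<pi> n))"
      using \<iota> \<pi> BS by (simp add: in_Hom)
    from kernel_factor[OF ker this \<pi>f\<iota>]
    obtain f where "f \<in> Hom C (I (Suc n)) (Dom C (\<iota> n))" "\<iota> n \<cdot> f = bond S n \<cdot> \<iota> (Suc n)" .
    then show "\<exists>f. f \<in> Hom C (I (Suc n)) (I n) \<and> \<iota> n \<cdot> f = bond S n \<cdot> \<iota> (Suc n)"
      using \<iota>(2) by auto
  qed
  then obtain f where f: "\<And>n. f n \<in> Hom C (I (Suc n)) (I n)"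
    and \<iota>f: "\<And>n. \<iota> n \<cdot> f n = bond S n \<cdot> \<iota> (Suc n)" by metis
  have "\<forall>n. \<exists>g. g \<in> Hom C (Cod C (\<pi> (Suc n))) (Cod C (\<pi> n)) \<and> g \<cdot> \<pi> (Suc n) = \<pi> n \<cdot> bond S n"
  proof
    fix n
    have g: "\<pi> n \<cdot> bond S n \<in> Hom C (Cod C (\<iota> (Suc n))) (Cod C (\<pi> n))"
      using \<iota> \<pi> BS by (simp add: in_Hom)
    have "(\<pi> n \<cdot> bond S n) \<cdot> \<iota> (Suc n) = Zero C (Dom C (\<iota> (Suc n))) (Cod C (\<pi> n))"
      using \<pi>f\<iota>[of n] \<iota> \<pi> BS by simp
    from cokernel_factor[OF coker g this]
    show "\<exists>g. g \<in> Hom C (Cod C (\<pi> (Suc n))) (Cod C (\<pi> n)) \<and> g \<cdot> \<pi> (Suc n) = \<pi> n \<cdot> bond S n"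
      by blast
  qed
  then obtain g where g: "\<And>n. g n \<in> Hom C (Cod C (\<pi> (Suc n))) (Cod C (\<pi> n))"
    and g\<pi>: "\<And>n. g n \<cdot> \<pi> (Suc n) = \<pi> n \<cdot> bond S n" by metis
  define E where "E = \<lparr>ob = I, bond = f\<rparr>"
  define T where "T = \<lparr>ob = \<lambda>n. Cod C (\<pi> n), bond = g\<rparr>"
  have ET: "ob E n = I n" "bond E n = f n" "ob T n = Cod C (\<pi> n)" "bond T n = g n" for n
    by (simp_all add: E_def T_def)
  have mi: "invseq_mor C E \<iota> S"
    using S f \<iota> \<iota>f Obj by (simp add: invseq_mor_def inverse_sequence_def ET in_Hom)
  have mp: "invseq_mor C S \<pi> T"
    using S g \<pi> g\<pi> Obj by (simp add: invseq_mor_def inverse_sequence_def ET in_Hom)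
  have fe: "f n \<cdot> e (Suc n) = e n" for n
  proof (rule monicD[OF kernel_monic[OF ker[of n]]])
    show "f n \<cdot> e (Suc n) \<in> Hom C L (Dom C (\<iota> n))" "e n \<in> Hom C L (Dom C (\<iota> n))"
      using f[of n] e \<iota> by (simp_all add: in_Hom)
    have "\<iota> n \<cdot> (f n \<cdot> e (Suc n)) = (\<iota> n \<cdot> f n) \<cdot> e (Suc n)"
      using f[of n] e \<iota> by (simp add: in_Hom)
    also have "\<dots> = bond S n \<cdot> (\<iota> (Suc n) \<cdot> e (Suc n))"
      unfolding \<iota>f using BS e \<iota> by simp
    also have "\<dots> = \<iota> n \<cdot> e n"
      unfolding \<iota>e lD(4) ..
    finally show "\<iota> n \<cdot> (f n \<cdot> e (Suc n)) = \<iota> n \<cdot> e n" .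
  qed
  have epi: "epimorphic C E"
    unfolding epimorphic_def
  proof
    fix n
    \<comment> \<open>The composite of the bond with \<open>e (Suc n)\<close> is the epimorphism
      \<open>e n\<close>, so the bond is epic.\<close>
    show "epic C (bond E n)"
      using epic_cancel[of "f n" "e (Suc n)"] fe[of n] e f[of n] by (simp add: in_Hom ET)
  qed
  have "t n = Zero C X (ob T n)" if t: "thread C T X t" for X t n
  proof -
    obtain R q y where q: "q \<in> Hom C R X" "epic C q" and y: "thread C S R y"
      and \<pi>y: "\<And>n. \<pi> n \<cdot> y n = t n \<cdot> q"
      by (rule thread_lifting_along_epi[OF mi mp ex epi t]) blast
    obtain w where w: "w \<in> Hom C R L" "l n \<cdot> w = y n"
      using univ[OF y] by blast
    have "t n \<cdot> q = (\<pi> n \<cdot> l n) \<cdot> w"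
      unfolding \<pi>y[symmetric] w(2)[symmetric] using \<pi> lD w(1) by (simp add: in_Hom)
    also have "\<dots> = Zero C R (ob T n)"
      unfolding \<pi>l using w(1) Obj by (simp add: in_Hom ET)
    finally show ?thesis
      using epic_zeroD[OF q(2), of "t n" "ob T n"] threadD[OF t] q(1) by (simp add: in_Hom)
  qed
  then show thesis using that mi mp ex epi by blast
qed

text \<open>A direct substitute for the snake lemma: \<open>c' v\<close> is a cokernel of
  \<open>1 - F\<close> on the product of \<open>S\<close>. If \<open>g\<close> kills that map, then
  \<open>g u\<close> kills the epic \<open>1 - F\<close> of \<open>E\<close>, so
  \<open>g u = 0\<close> and \<open>g = h v\<close>; cancelling \<open>v\<close> shows that
  \<open>h\<close> kills \<open>1 - F\<close> of \<open>T\<close>, so \<open>h\<close> factors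
  through \<open>c'\<close>.\<close>

lemma Lim1_isomorphic:
  assumes i: "invseq_mor C E \<iota> S" and p: "invseq_mor C S \<pi> T"
    and ex: "\<And>n. short_exact C (\<iota> n) (\<pi> n)" and epi: "epimorphic C E"
  shows "isomorphic C (Lim1_obj C S) (Lim1_obj C T)"
proof -
  note I = invseq_morD[OF i] and P = invseq_morD[OF p]
  have invs: "inverse_sequence C E" "inverse_sequence C S" "inverse_sequence C T"
    using i p by (auto simp: invseq_mor_def)
  have Lim1: "\<exists>P pr F c. shift_data S P pr F \<and> is_cokernel C c (one_minus P F) \<and> Lim1_obj C S = Cod C c"
    if S: "inverse_sequence C S" for S
  proof -
    obtain P pr F where "shift_data S P pr F"
      using shift_data_ex[OF S] .
    then have "\<exists>L. is_Lim1 C S L"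
      using cokernel_ex one_minus_Hom is_shift_difference_iff[OF S]
      unfolding is_Lim1_def by (metis in_Hom)
    then have "is_Lim1 C S (Lim1_obj C S)"
      unfolding Lim1_obj_def by (rule someI_ex)
    then show ?thesis
      using is_shift_difference_iff[OF S] unfolding is_Lim1_def by metis
  qed
  obtain PS prS FS c where SS: "shift_data S PS prS FS" and c: "is_cokernel C c (one_minus PS FS)"
    and LS: "Lim1_obj C S = Cod C c"
    using Lim1[OF invs(2)] by blast
  obtain PT prT FT c' where ST: "shift_data T PT prT FT" and c': "is_cokernel C c' (one_minus PT FT)"
    and LT: "Lim1_obj C T = Cod C c'"
    using Lim1[OF invs(3)] by blast
  obtain PE prE FE where SE: "shift_data E PE prE FE" using shift_data_ex[OF invs(1)] .
  note DE = shift_dataD[OF SE] and DS = shift_dataD[OF SS] and DT = shift_dataD[OF ST]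
  obtain u where u: "u \<in> Hom C PE PS" "\<And>n. prS n \<cdot> u = \<iota> n \<cdot> prE n"
    using product_map[OF DS(2) _ DE(3), of "\<lambda>n. \<iota> n \<cdot> prE n"] I DE by (auto simp: in_Hom)
  obtain v where v: "v \<in> Hom C PS PT" "\<And>n. prT n \<cdot> v = \<pi> n \<cdot> prS n"
    using product_map[OF DT(2) _ DS(3), of "\<lambda>n. \<pi> n \<cdot> prS n"] P DS by (auto simp: in_Hom)
  have "short_exact C u v"
    by (rule product_short_exact[OF small_nat[OF inaccessible] _ DE(2) DS(2) DT(2) u v])
      (use I P ex in \<open>simp add: in_Hom\<close>)
  then have vc: "is_cokernel C v u" by (simp add: short_exact_def)
  let ?dE = "one_minus PE FE" and ?dS = "one_minus PS FS" and ?dT = "one_minus PT FT"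
  note dE = one_minus_Hom[OF SE] and dS = one_minus_Hom[OF SS] and dT = one_minus_Hom[OF ST]
  \<comment> \<open>\<open>1 - F\<close> commutes with the maps induced on products; needed for both
    \<open>u\<close> and \<open>v\<close>.\<close>
  have natural: "w \<cdot> one_minus PA FA = one_minus PB FB \<cdot> w"
    if SA: "shift_data A PA prA FA" and SB: "shift_data B PB prB FB" and m: "invseq_mor C A \<mu> B"
      and w: "w \<in> Hom C PA PB" "\<And>n. prB n \<cdot> w = \<mu> n \<cdot> prA n"
    for A PA prA FA B PB prB FB \<mu> w
  proof (rule product_eqI[OF shift_dataD(2)[OF SB]])
    note DA = shift_dataD[OF SA] and DB = shift_dataD[OF SB] and M = invseq_morD[OF m]
    note BA = inverse_sequenceD[OF DA(1)] and BB = inverse_sequenceD[OF DB(1)]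
    show "w \<cdot> one_minus PA FA \<in> Hom C PA PB" "one_minus PB FB \<cdot> w \<in> Hom C PA PB"
      using one_minus_Hom[OF SA] one_minus_Hom[OF SB] w(1) Comp_Hom by blast+
    fix n
    have d: "one_minus PA FA \<in> Arr C" "Dom C (one_minus PA FA) = PA" "Cod C (one_minus PA FA) = PA"
      using one_minus_Hom[OF SA] by (auto simp: in_Hom)
    have "prB n \<cdot> (w \<cdot> one_minus PA FA) = (prB n \<cdot> w) \<cdot> one_minus PA FA"
      using d w(1) DB by (simp add: in_Hom)
    also have "\<dots> = \<mu> n \<cdot> (prA n \<cdot> (one_minus PA FA \<cdot> Ident C PA))"
      unfolding w(2) using d DA M by simp
    also have "\<dots> = \<mu> n \<cdot> Diff C (prA n) (bond A n \<cdot> prA (Suc n))"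
      using proj_one_minus[OF SA Ident_Hom[OF DA(3)], of n] DA by simp
    also have "\<dots> = Diff C (\<mu> n \<cdot> prA n) ((\<mu> n \<cdot> bond A n) \<cdot> prA (Suc n))"
      using DA M(1-3) BA by (simp add: Comp_Diff)
    also have "\<dots> = Diff C (prB n \<cdot> w) (bond B n \<cdot> (prB (Suc n) \<cdot> w))"
      unfolding M(4) w(2) using DA M(1-3) BB by simp
    also have "\<dots> = prB n \<cdot> (one_minus PB FB \<cdot> w)"
      using proj_one_minus[OF SB w(1), of n] by simp
    finally show "prB n \<cdot> (w \<cdot> one_minus PA FA) = prB n \<cdot> (one_minus PB FB \<cdot> w)" .
  qed
  note un = natural[OF SE SS i u] and vn = natural[OF SS ST p v]
  have dA: "?dE \<in> Arr C" "Dom C ?dE = PE" "Cod C ?dE = PE" "?dS \<in> Arr C" "Dom C ?dS = PS"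
    "Cod C ?dS = PS" "?dT \<in> Arr C" "Dom C ?dT = PT" "Cod C ?dT = PT"
    using dE dS dT by (simp_all add: in_Hom)
  have uA: "u \<in> Arr C" "Dom C u = PE" "Cod C u = PS" "v \<in> Arr C" "Dom C v = PS" "Cod C v = PT"
    using u v by (auto simp: in_Hom)
  have cA: "c' \<in> Arr C" "Dom C c' = PT" "c' \<cdot> ?dT = Zero C PT (Cod C c')"
    using c' dA by (auto simp: is_cokernel_def)
  have O: "Cod C c' \<in> Obj C" using cA Cod_Obj by blast
  have "is_cokernel C (c' \<cdot> v) ?dS"
  proof (rule is_cokernelI)
    have "(c' \<cdot> v) \<cdot> ?dS = (c' \<cdot> ?dT) \<cdot> v"
      using vn cA(1,2) dA uA by simp
    then show "(c' \<cdot> v) \<cdot> ?dS = Zero C (Dom C ?dS) (Cod C (c' \<cdot> v))"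
      unfolding cA(3) using cA(1,2) uA dA O by simp
    show "epic C (c' \<cdot> v)"
      using epic_Comp[OF cokernel_epic[OF vc] cokernel_epic[OF c']] cA uA by simp
    fix b g assume g: "g \<in> Hom C (Cod C ?dS) b" "g \<cdot> ?dS = Zero C (Dom C ?dS) b"
    have gA: "g \<in> Arr C" "Dom C g = PS" "Cod C g = b" "b \<in> Obj C"
      using g(1) dA Hom_Obj[OF g(1)] by (auto simp: in_Hom)
    have "(g \<cdot> u) \<cdot> ?dE = (g \<cdot> ?dS) \<cdot> u"
      using un gA dA uA by simp
    also have "\<dots> = Zero C PE b"
      unfolding g(2) using uA dA gA by simp
    finally have "g \<cdot> u = Zero C PE b"
      using epic_zeroD[OF epimorphic_one_minus_epic[OF SE epi], of "g \<cdot> u" b] gA uA dA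
      by (simp add: in_Hom)
    then obtain h where h: "h \<in> Hom C PT b" "h \<cdot> v = g"
      using cokernel_factor[OF vc, of g b] gA uA by (auto simp: in_Hom)
    have "(h \<cdot> ?dT) \<cdot> v = (h \<cdot> v) \<cdot> ?dS"
      using vn h(1) dA uA by (simp add: in_Hom)
    also have "\<dots> = Zero C PS b"
      unfolding h(2) g(2) using dA by simp
    finally have "h \<cdot> ?dT = Zero C PT b"
      using epic_zeroD[OF cokernel_epic[OF vc], of "h \<cdot> ?dT" b] h(1) dA uA by (simp add: in_Hom)
    then obtain k where k: "k \<in> Hom C (Cod C c') b" "k \<cdot> c' = h"
      using cokernel_factor[OF c', of h b] h(1) dA by (auto simp: in_Hom)
    have "k \<cdot> (c' \<cdot> v) = g"
      using Comp_assoc_Arr[of v c' k] k h(2) cA uA by (simp add: in_Hom)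
    then show "\<exists>u\<in>Hom C (Cod C (c' \<cdot> v)) b. u \<cdot> (c' \<cdot> v) = g"
      using k(1) cA uA by auto
  qed (use cA uA dA in simp_all)
  from cokernels_isomorphic[OF c this] show ?thesis
    unfolding LS LT using cA uA by simp
qed

section \<open>Uniqueness and transfer to arbitrary sequences\<close>

lemma epi_lim_zero_sequence_Comp_zero:
  assumes "epi_lim_zero_sequence C S i p" "epi_lim_zero_sequence C S i' p'"
  shows "Comp (invseq_cat C) p' i = Zero (invseq_cat C) (Dom (invseq_cat C) i) (Cod (invseq_cat C) p')"
proof -
  obtain E \<iota> S1 S2 \<pi> T where i: "i = (E, \<iota>, S1)" and p': "p' = (S2, \<pi>, T)"
    by (cases i, cases p')
  have exact: "short_exact (invseq_cat C) i p" "short_exact (invseq_cat C) i' p'"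
    and Cod: "Cod (invseq_cat C) i = S" "Cod (invseq_cat C) i' = S"
    and epi: "epimorphic C E" and z: "zero_object C (Lim_obj C T)"
    using assms by (auto simp add: epi_lim_zero_sequence_def i p')
  have S: "S1 = S" "S2 = S"
    using short_exactD(3)[OF exact(2)] Cod by (simp_all add: i p')
  have m: "invseq_mor C E \<iota> S" "invseq_mor C S \<pi> T"
    using short_exactD(1)[OF exact(1)] short_exactD(2)[OF exact(2)] by (simp_all add: i p' S)
  have "inverse_sequence C T" using m by (simp add: invseq_mor_def)
  \<comment> \<open>The composite leads from the epimorphic part of one sequence to the quotient
    with zero limit of the other.\<close>
  then have "\<pi> n \<cdot> \<iota> n = Zero C (ob E n) (ob T n)" for n
    using epimorphic_to_lim_zero[OF invseq_mor_Comp[OF m] epi] z Lim_obj_zero_iff by blast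
  then show ?thesis
    by (simp add: i p' S)
qed

lemma epi_lim_zero_sequence_unique:
  assumes "epi_lim_zero_sequence C S i p" "epi_lim_zero_sequence C S i' p'"
  shows "\<exists>\<phi> \<psi>. \<phi> \<in> Hom (invseq_cat C) (Dom (invseq_cat C) i) (Dom (invseq_cat C) i') \<and>
    isomorphism (invseq_cat C) \<phi> \<and>
    \<psi> \<in> Hom (invseq_cat C) (Cod (invseq_cat C) p) (Cod (invseq_cat C) p') \<and>
    isomorphism (invseq_cat C) \<psi> \<and>
    Comp (invseq_cat C) i' \<phi> = i \<and> Comp (invseq_cat C) \<psi> p = p'"
  using assms epi_lim_zero_sequence_Comp_zero[OF assms]
    epi_lim_zero_sequence_Comp_zero[OF assms(2,1)]
  by (intro category.short_exact_unique[OF invseq_category])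
    (auto simp: epi_lim_zero_sequence_def)

text \<open>Componentwise exactness is kept in the conclusion because the comparison of
  \<open>lim^1\<close> needs it.\<close>

lemma epi_lim_zero_sequence_ex:
  assumes S: "inverse_sequence C S"
  obtains E \<iota> \<pi> T where "epi_lim_zero_sequence C S (E, \<iota>, S) (S, \<pi>, T)"
    "invseq_mor C E \<iota> S" "\<And>n. short_exact C (\<iota> n) (\<pi> n)"
proof -
  obtain E \<iota> \<pi> T where *: "invseq_mor C E \<iota> S" "invseq_mor C S \<pi> T"
    "\<And>n. short_exact C (\<iota> n) (\<pi> n)" "epimorphic C E"
    "\<And>X t n. thread C T X t \<Longrightarrow> t n = Zero C X (ob T n)"
    using epimorphic_lim_zero_ex[OF S] by metis
  have "inverse_sequence C T" using *(2) by (simp add: invseq_mor_def)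
  then have "epi_lim_zero_sequence C S (E, \<iota>, S) (S, \<pi>, T)"
    using * invseq_short_exactI[OF *(1-3)] Lim_obj_zero_iff
    by (auto simp: epi_lim_zero_sequence_def)
  then show thesis using that * by blast
qed

text \<open>A given sequence is known to be exact only in \<open>invseq_cat C\<close>. Rather than
  deriving exactness of its components, the proof uses uniqueness to compare it with the constructed
  one, whose components are exact.\<close>

lemma epi_lim_zero_sequence_Lim1:
  assumes S: "inverse_sequence C S" and ip: "epi_lim_zero_sequence C S i p"
  shows "isomorphic C (Lim1_obj C S) (Lim1_obj C (Cod (invseq_cat C) p))"
proof -
  obtain E \<iota> \<pi> T where ex: "epi_lim_zero_sequence C S (E, \<iota>, S) (S, \<pi>, T)"
    "invseq_mor C E \<iota> S" "\<And>n. short_exact C (\<iota> n) (\<pi> n)"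
    using epi_lim_zero_sequence_ex[OF S] by metis
  let ?T' = "Cod (invseq_cat C) p"
  obtain \<psi> where \<psi>: "isomorphism (invseq_cat C) \<psi>" "\<psi> \<in> Hom (invseq_cat C) T ?T'"
    and p: "Comp (invseq_cat C) \<psi> (S, \<pi>, T) = p"
    using epi_lim_zero_sequence_unique[OF ex(1) ip] by auto
  obtain \<chi> where \<chi>: "\<psi> = (T, \<chi>, ?T')" "invseq_mor C T \<chi> ?T'"
    using \<psi>(2) by (auto simp: Hom_invseq_cat)
  have epi: "epimorphic C E" and \<pi>: "invseq_mor C S \<pi> T"
    using ex(1) short_exactD(2) by (fastforce simp: epi_lim_zero_sequence_def)+
  have "short_exact C (\<iota> n) (\<chi> n \<cdot> \<pi> n)" for n
    using short_exact_Comp_isomorphism[OF ex(3), of "\<chi> n" n]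
      invseq_isomorphism_components[OF \<psi>(1)[unfolded \<chi>(1)]] invseq_morD[OF \<pi>] invseq_morD[OF \<chi>(2)]
    by simp
  then show ?thesis
    using Lim1_isomorphic[OF ex(2) invseq_mor_Comp[OF \<pi> \<chi>(2)] _ epi] by blast
qed

end

theorem corollary1p5:
  fixes C :: "('o, 'm) precat"
    and \<kappa> :: "'k rel"
    and S :: "('o, 'm) invseq"
  assumes "inaccessible \<kappa>"
    and "abelian_category C"
    and "locally_small \<kappa> C"
    and "\<exists>G. generator C G"
    and "has_small_coproducts \<kappa> C"
    and "has_small_products \<kappa> C"
    and "small_products_exact \<kappa> C"
    and "inverse_sequence C S"
  shows "(\<exists>i p. epi_lim_zero_sequence C S i p) \<and>
    (\<forall>i p i' p'. epi_lim_zero_sequence C S i p \<and> epi_lim_zero_sequence C S i' p' \<longrightarrow>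
      (\<exists>\<phi> \<psi>.
        \<phi> \<in> Hom (invseq_cat C) (Dom (invseq_cat C) i) (Dom (invseq_cat C) i') \<and>
        isomorphism (invseq_cat C) \<phi> \<and>
        \<psi> \<in> Hom (invseq_cat C) (Cod (invseq_cat C) p) (Cod (invseq_cat C) p') \<and>
        isomorphism (invseq_cat C) \<psi> \<and>
        Comp (invseq_cat C) i' \<phi> = i \<and>
        Comp (invseq_cat C) \<psi> p = p')) \<and>
    (\<forall>i p. epi_lim_zero_sequence C S i p \<longrightarrow>
      isomorphic C (Lim1_obj C S) (Lim1_obj C (Cod (invseq_cat C) p)))"
proof -
  obtain G where "generator C G" using assms(4) by blast
  then interpret ab4star_category C \<kappa> G
    using assms by (simp add: ab4star_category_def ab4star_category_axioms_def)
  show ?thesis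
    using epi_lim_zero_sequence_ex[OF assms(8)] epi_lim_zero_sequence_unique
      epi_lim_zero_sequence_Lim1[OF assms(8)] by meson
qed

end
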